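(* Let $\Gamma$ be a connected amply regular graph with diameter $d=4$ and parameters $(v,k,\lambda,\mu)$, where $\mu=\frac{k-1}{2}$ and $k\ge5$ is odd. Then either $\Gamma\cong \mathrm{K}_2\,\square\,\Delta_{4.1}$, or $\Gamma$ is bipartite and, for a vertex $x$, admits an equitable partition $D_0=\{x\}$, $D_1=\Gamma(x)$, $D_2=\Gamma_2(x)$, $D_3$, $D_3'$ (with $D_3\cup D_3'=\Gamma_3(x)$), $D_4=\Gamma_4(x)$ of sizes $1,k,2k,k,2,1$ with quotient numbers (number of neighbours of a vertex of the first cell in the second cell, all others $0$): $D_0\to D_1: k$; $D_1\to D_0: 1$, $D_1\to D_2: k-1$; $D_2\to D_1: \frac{k-1}{2}$, $D_2\to D_3: \frac{k-1}{2}$, $D_2\to D_3': 1$; $D_3\to D_2: k-1$, $D_3\to D_4: 1$; $D_3'\to D_2: k$; $D_4\to D_3: k$.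
   Context: An amply regular graph with parameters $(v,k,\lambda,\mu)$ is a $k$-regular graph on $v$ vertices in which adjacent vertices have exactly $\lambda$ common neighbours and vertices at distance $2$ have exactly $\mu$ common neighbours. $\Gamma_i(x)$ is the set of vertices at distance $i$ from $x$. $\square$ is the Cartesian product, $\mathrm{K}_2$ a single edge, and $\Delta_{4.1}$ the point-block incidence graph of the square $2$-$(7,4,2)$ design. A partition is equitable if each vertex of cell $B_i$ has the same number $q_{ij}$ of neighbours in cell $B_j$. In the paper the partition is given by a figure; it is written out here explicitly. *)

theory Defs
  imports Main
begin

definition simple_graph :: "'a set \<Rightarrow> ('a \<Rightarrow> 'a \<Rightarrow> bool) \<Rightarrow> bool" where
  "simple_graph V E \<longleftrightarrow> finite V \<and> (\<forall>x y. E x y \<longrightarrow> x \<in> V \<and> y \<in> V)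
     \<and> (\<forall>x y. E x y \<longrightarrow> E y x) \<and> (\<forall>x. \<not> E x x)"

definition nbrs :: "'a set \<Rightarrow> ('a \<Rightarrow> 'a \<Rightarrow> bool) \<Rightarrow> 'a \<Rightarrow> 'a set" where
  "nbrs V E x = {y \<in> V. E x y}"

definition walk :: "'a set \<Rightarrow> ('a \<Rightarrow> 'a \<Rightarrow> bool) \<Rightarrow> 'a \<Rightarrow> 'a \<Rightarrow> nat \<Rightarrow> bool" where
  "walk V E x y n \<longleftrightarrow> (\<exists>p. length p = Suc n \<and> set p \<subseteq> V \<and> p ! 0 = x \<and> p ! n = y
      \<and> (\<forall>i<n. E (p ! i) (p ! Suc i)))"

definition dist_is :: "'a set \<Rightarrow> ('a \<Rightarrow> 'a \<Rightarrow> bool) \<Rightarrow> 'a \<Rightarrow> 'a \<Rightarrow> nat \<Rightarrow> bool" where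
  "dist_is V E x y n \<longleftrightarrow> walk V E x y n \<and> (\<forall>m<n. \<not> walk V E x y m)"

definition Gam :: "'a set \<Rightarrow> ('a \<Rightarrow> 'a \<Rightarrow> bool) \<Rightarrow> nat \<Rightarrow> 'a \<Rightarrow> 'a set" where
  "Gam V E i x = {y \<in> V. dist_is V E x y i}"

definition connected_graph :: "'a set \<Rightarrow> ('a \<Rightarrow> 'a \<Rightarrow> bool) \<Rightarrow> bool" where
  "connected_graph V E \<longleftrightarrow> V \<noteq> {} \<and> (\<forall>x\<in>V. \<forall>y\<in>V. \<exists>n. walk V E x y n)"

definition has_diameter :: "'a set \<Rightarrow> ('a \<Rightarrow> 'a \<Rightarrow> bool) \<Rightarrow> nat \<Rightarrow> bool" where
  "has_diameter V E d \<longleftrightarrow> (\<forall>x\<in>V. \<forall>y\<in>V. \<exists>n\<le>d. walk V E x y n)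
     \<and> (\<exists>x\<in>V. \<exists>y\<in>V. dist_is V E x y d)"

definition amply_regular ::
  "'a set \<Rightarrow> ('a \<Rightarrow> 'a \<Rightarrow> bool) \<Rightarrow> nat \<Rightarrow> nat \<Rightarrow> nat \<Rightarrow> nat \<Rightarrow> bool" where
  "amply_regular V E v k lam mu \<longleftrightarrow> simple_graph V E \<and> card V = v
     \<and> (\<forall>x\<in>V. card (nbrs V E x) = k)
     \<and> (\<forall>x\<in>V. \<forall>y\<in>V. E x y \<longrightarrow> card (nbrs V E x \<inter> nbrs V E y) = lam)
     \<and> (\<forall>x\<in>V. \<forall>y\<in>V. dist_is V E x y 2 \<longrightarrow> card (nbrs V E x \<inter> nbrs V E y) = mu)"

definition bipartite :: "'a set \<Rightarrow> ('a \<Rightarrow> 'a \<Rightarrow> bool) \<Rightarrow> bool" where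
  "bipartite V E \<longleftrightarrow> (\<exists>A\<subseteq>V. \<forall>x y. E x y \<longrightarrow> (x \<in> A \<longleftrightarrow> y \<notin> A))"

definition graph_iso ::
  "'a set \<Rightarrow> ('a \<Rightarrow> 'a \<Rightarrow> bool) \<Rightarrow> 'b set \<Rightarrow> ('b \<Rightarrow> 'b \<Rightarrow> bool) \<Rightarrow> bool" where
  "graph_iso V E V' E' \<longleftrightarrow> (\<exists>f. bij_betw f V V' \<and> (\<forall>x\<in>V. \<forall>y\<in>V. E x y \<longleftrightarrow> E' (f x) (f y)))"

definition cart_V :: "'a set \<Rightarrow> 'b set \<Rightarrow> ('a \<times> 'b) set" where
  "cart_V V1 V2 = V1 \<times> V2"

definition cart_E :: "('a \<Rightarrow> 'a \<Rightarrow> bool) \<Rightarrow> ('b \<Rightarrow> 'b \<Rightarrow> bool) \<Rightarrow> 'a \<times> 'b \<Rightarrow> 'a \<times> 'b \<Rightarrow> bool" where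
  "cart_E E1 E2 u w \<longleftrightarrow> (E1 (fst u) (fst w) \<and> snd u = snd w) \<or> (fst u = fst w \<and> E2 (snd u) (snd w))"

definition K2_V :: "bool set" where "K2_V = UNIV"
definition K2_E :: "bool \<Rightarrow> bool \<Rightarrow> bool" where "K2_E a b \<longleftrightarrow> a \<noteq> b"

text \<open>Delta_{4.1}: point-block incidence graph of the (unique) square 2-(7,4,2) design,
realised as the complement of the Fano plane: points 0..6, blocks B_i = i + {2,4,5,6} mod 7
(the complement of the perfect difference set {0,1,3}). Points are Inl p, blocks Inr i.\<close>
definition inc41 :: "nat \<Rightarrow> nat \<Rightarrow> bool" where
  "inc41 p i \<longleftrightarrow> p < 7 \<and> i < 7 \<and> (p + 7 - i) mod 7 \<in> {2, 4, 5, 6}"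

definition Delta41_V :: "(nat + nat) set" where
  "Delta41_V = Inl ` {..<7} \<union> Inr ` {..<7}"

definition Delta41_E :: "nat + nat \<Rightarrow> nat + nat \<Rightarrow> bool" where
  "Delta41_E a b = (case (a, b) of (Inl p, Inr i) \<Rightarrow> inc41 p i
                                | (Inr i, Inl p) \<Rightarrow> inc41 p i
                                | _ \<Rightarrow> False)"

definition equitable_partition ::
  "'a set \<Rightarrow> ('a \<Rightarrow> 'a \<Rightarrow> bool) \<Rightarrow> 'a set list \<Rightarrow> nat list list \<Rightarrow> bool" where
  "equitable_partition V E C Q \<longleftrightarrow>
     \<Union> (set C) = V
     \<and> (\<forall>i<length C. \<forall>j<length C. i \<noteq> j \<longrightarrow> C ! i \<inter> C ! j = {})
     \<and> length Q = length C \<and> (\<forall>i<length C. length (Q ! i) = length C)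
     \<and> (\<forall>i<length C. \<forall>j<length C. \<forall>y\<in>C ! i. card (nbrs V E y \<inter> C ! j) = Q ! i ! j)"

end

(*
Two vertices x, y are far if no walk of length at most 3 joins them, and M(x,y) is the set of vertices at
distance 2 from both. For z in M(x,y), mu neighbours of z lie in N(x) and mu in N(y), so exactly one
neighbour e(z) is left over since k = 2 mu + 1. A count inside N(x), M(x,y), N(y) forces lambda = 0.
Let W(x,y) be the part of Gamma_2(x) outside M(x,y). If W(x,y) is empty, counting the common neighbours of
the vertices of M(x,y) with the same e(z) shows that e(z) has all its neighbours in M(x,y); hence there
are exactly two such vertices (the cell D3'), the graph is bipartite on 4k + 4 vertices, and every
vertex has a partner with the same property. For mu >= 3 a double count gives W(x,y) = {}. For mu = 2
(k = 5) the pairs in N(x) correspond to Gamma_2(x), and if W(x,y) is nonempty, then counting edges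
leaves |W(x,y)| = 2 as the only possibility; this determines all 28 vertices and 70 edges.
*)
theory Submission
  imports Defs
begin

section \<open>Walks and distances\<close>

text \<open>The relation mu = (k - 1) / 2 makes every count tight: |Gamma_2(x)| = k (k - 1) / mu =
  2k, and a vertex of \<open>M x y\<close> has one neighbour whose position is unknown. Most
  arguments therefore bound the parts of a neighbourhood from below and find that they already
  exhaust it. The obstacle is that a vertex at distance 2 from \<open>x\<close> need not be at
  distance 2 from \<open>y\<close>; \<open>W x y\<close> collects these failures. The count that
  excludes them compares |T| (m - 2) with (m - 1) (m - 2), where T consists of the neighbours in
  \<open>M x y\<close> of one neighbour of \<open>x\<close>. It is void for m = 2, so valency 5
  stands apart. The diameter provides one far pair, while the partition is claimed at every vertex.
  Both colour classes turn out to have 2k + 2 vertices, one more than a vertex together with its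
  second neighbourhood, and the missing vertex is the partner. In the exceptional case only edges
  are derived, never non-edges: an injective edge-preserving map between 5-regular graphs leaves no
  room for further edges.\<close>

locale sgraph =
  fixes V :: "'a set" and E :: "'a \<Rightarrow> 'a \<Rightarrow> bool"
  assumes simple: "simple_graph V E"
begin

abbreviation N where "N \<equiv> nbrs V E"

lemma finite_V: "finite V"
  and E_in_V: "E x y \<Longrightarrow> x \<in> V" "E x y \<Longrightarrow> y \<in> V"
  and E_sym: "E x y \<Longrightarrow> E y x"
  and E_irrefl: "\<not> E x x"
  using simple by (auto simp: simple_graph_def)

lemma N_iff [simp]: "y \<in> N x \<longleftrightarrow> E x y"
  using E_in_V by (auto simp: nbrs_def)

lemma N_subset: "N x \<subseteq> V" and finite_N [simp]: "finite (N x)"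
  using finite_V by (auto simp: nbrs_def)

lemma E_commute: "E x y \<longleftrightarrow> E y x"
  using E_sym by blast

lemma card_edges_commute:
  assumes "finite A" "finite B"
  shows "(\<Sum>a\<in>A. card (N a \<inter> B)) = (\<Sum>b\<in>B. card (N b \<inter> A))"
proof -
  have "(\<Sum>a\<in>A. card {b\<in>B. E a b}) = (\<Sum>b\<in>B. card {a\<in>A. E a b})"
    using assms by (intro sum_multicount_gen) auto
  moreover have "N a \<inter> B = {b\<in>B. E a b}" "N b \<inter> A = {a\<in>A. E a b}" for a b
    by (auto simp: E_commute)
  ultimately show ?thesis by simp
qed

lemma walk_0: "walk V E x y 0 \<longleftrightarrow> x = y \<and> x \<in> V"
  unfolding walk_def by (auto simp: length_Suc_conv intro!: exI[of _ "[x]"])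

lemma walk_Suc: "walk V E x z (Suc n) \<longleftrightarrow> (\<exists>y. walk V E x y n \<and> E y z)"
proof
  assume "walk V E x z (Suc n)"
  then obtain p where p: "length p = Suc (Suc n)" "set p \<subseteq> V" "p ! 0 = x" "p ! Suc n = z"
    "\<forall>i<Suc n. E (p ! i) (p ! Suc i)" unfolding walk_def by blast
  have "set (butlast p) \<subseteq> V" using p(2) by (meson in_set_butlastD subset_iff)
  then have "walk V E x (p ! n) n" unfolding walk_def
    using p by (intro exI[of _ "butlast p"]) (auto simp: nth_butlast)
  moreover have "E (p ! n) z" using p by auto
  ultimately show "\<exists>y. walk V E x y n \<and> E y z" by blast
next
  assume "\<exists>y. walk V E x y n \<and> E y z"
  then obtain y p where p: "length p = Suc n" "set p \<subseteq> V" "p ! 0 = x" "p ! n = y"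
    "\<forall>i<n. E (p ! i) (p ! Suc i)" and E: "E y z" unfolding walk_def by blast
  show "walk V E x z (Suc n)" unfolding walk_def
    using p E E_in_V(2)[OF E]
    by (intro exI[of _ "p @ [z]"]) (auto simp: nth_append less_Suc_eq)
qed

text \<open>Distance at least 4 (or no walk at all), spelled out through edges so that the
  combinatorics never handles walks; \<open>far_walk\<close> is the translation.\<close>

definition far :: "'a \<Rightarrow> 'a \<Rightarrow> bool" where
  "far x y \<longleftrightarrow> x \<in> V \<and> y \<in> V \<and> x \<noteq> y \<and> \<not> E x y \<and> N x \<inter> N y = {} \<and> (\<forall>a\<in>N x. \<forall>b\<in>N y. \<not> E a b)"

text \<open>Only common neighbours are asked for; for a far pair the members are then at distance
  exactly 2 from both ends (\<open>M_apart\<close>).\<close>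

definition M :: "'a \<Rightarrow> 'a \<Rightarrow> 'a set" where
  "M x y = {z \<in> V. N z \<inter> N x \<noteq> {} \<and> N z \<inter> N y \<noteq> {}}"

text \<open>In a graph without triangles no neighbour of \<open>x\<close> has a neighbour in
  \<open>N x\<close>, so there this is Gamma_2(x).\<close>

definition G2 :: "'a \<Rightarrow> 'a set" where
  "G2 x = {z \<in> V. z \<noteq> x \<and> N z \<inter> N x \<noteq> {}}"

lemma far_iff: "far x y \<longleftrightarrow> x \<in> V \<and> y \<in> V \<and> x \<noteq> y \<and> \<not> E x y \<and>
    (\<forall>a. E x a \<longrightarrow> \<not> E y a) \<and> (\<forall>a b. E x a \<longrightarrow> E y b \<longrightarrow> \<not> E a b)"
  unfolding far_def disjoint_iff Ball_def N_iff by blast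

lemma M_iff: "z \<in> M x y \<longleftrightarrow> (\<exists>a. E x a \<and> E a z) \<and> (\<exists>b. E y b \<and> E b z)"
  unfolding M_def mem_Collect_eq disjoint_iff N_iff using E_in_V(2) E_sym by blast

lemma G2_iff: "z \<in> G2 x \<longleftrightarrow> z \<noteq> x \<and> (\<exists>a. E x a \<and> E a z)"
  unfolding G2_def mem_Collect_eq disjoint_iff N_iff using E_in_V(2) E_sym by blast

lemma far_sym: "far x y \<Longrightarrow> far y x"
  unfolding far_iff using E_sym by blast

lemma M_sym: "M x y = M y x"
  unfolding M_def by blast

lemma finite_M [simp]: "finite (M x y)" and finite_G2 [simp]: "finite (G2 x)"
  using finite_V by (auto simp: M_def G2_def)

lemma far_walk: "far x y \<longleftrightarrow> x \<in> V \<and> y \<in> V \<and> (\<forall>n<4. \<not> walk V E x y n)"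
proof -
  have "(\<forall>n<4. \<not> walk V E x y n) \<longleftrightarrow>
    \<not> walk V E x y 0 \<and> \<not> walk V E x y (Suc 0) \<and> \<not> walk V E x y (Suc (Suc 0)) \<and> \<not> walk V E x y (Suc (Suc (Suc 0)))"
    by (auto simp: numeral_eq_Suc less_Suc_eq)
  also have "\<dots> \<longleftrightarrow> \<not> (x = y \<and> x \<in> V) \<and> \<not> E x y \<and> (\<forall>a. E x a \<longrightarrow> \<not> E a y) \<and> (\<forall>a b. E x a \<longrightarrow> E a b \<longrightarrow> \<not> E b y)"
    using E_in_V by (auto simp: walk_0 walk_Suc)
  finally show ?thesis unfolding far_iff E_commute[of y] by blast
qed

text \<open>Here diameter 4 enters: the ends of a far pair are joined by a walk of length 4, so
  their \<open>M\<close> is nonempty.\<close>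

lemma M_walk: "M x y \<noteq> {} \<longleftrightarrow> walk V E x y 4"
proof -
  have "walk V E x y 4 \<longleftrightarrow> (\<exists>a z b. E x a \<and> E a z \<and> E z b \<and> E b y)"
    using E_in_V by (auto simp: numeral_eq_Suc walk_0 walk_Suc)
  then show ?thesis unfolding ex_in_conv[symmetric] M_iff E_commute[of y]
    using E_sym by blast
qed

lemma dist_is_1: "dist_is V E x y 1 \<longleftrightarrow> E x y"
  unfolding dist_is_def using E_in_V E_irrefl by (auto simp: walk_0 walk_Suc)

lemma dist_is_2: "dist_is V E x y 2 \<longleftrightarrow> x \<noteq> y \<and> \<not> E x y \<and> N x \<inter> N y \<noteq> {}"
proof -
  have "(\<forall>n<2. \<not> walk V E x y n) \<longleftrightarrow> \<not> walk V E x y 0 \<and> \<not> walk V E x y (Suc 0)"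
    by (auto simp: numeral_eq_Suc less_Suc_eq)
  moreover have "walk V E x y 2 \<longleftrightarrow> (\<exists>z. E x z \<and> E z y)"
    using E_in_V by (auto simp: numeral_eq_Suc walk_0 walk_Suc)
  ultimately show ?thesis unfolding dist_is_def
    using E_in_V by (auto simp: walk_0 walk_Suc E_commute[of y] disjoint_iff)
qed

lemma dist_is_3: "dist_is V E x y 3 \<longleftrightarrow> x \<noteq> y \<and> \<not> E x y \<and> N x \<inter> N y = {} \<and> (\<exists>a b. E x a \<and> E a b \<and> E b y)"
proof -
  have "(\<forall>n<3. \<not> walk V E x y n) \<longleftrightarrow>
    \<not> walk V E x y 0 \<and> \<not> walk V E x y (Suc 0) \<and> \<not> walk V E x y (Suc (Suc 0))"
    by (auto simp: numeral_eq_Suc less_Suc_eq)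
  moreover have "walk V E x y 3 \<longleftrightarrow> (\<exists>a b. E x a \<and> E a b \<and> E b y)"
    using E_in_V by (auto simp: numeral_eq_Suc walk_0 walk_Suc)
  ultimately show ?thesis unfolding dist_is_def
    using E_in_V by (auto simp: walk_0 walk_Suc E_commute[of y] disjoint_iff)
qed

lemma dist_is_4: "dist_is V E x y 4 \<longleftrightarrow> far x y \<and> M x y \<noteq> {}"
proof -
  have "x \<in> V \<and> y \<in> V" if "walk V E x y 4"
    using that E_in_V unfolding M_walk[symmetric] M_iff ex_in_conv[symmetric] by blast
  then show ?thesis unfolding dist_is_def far_walk M_walk by blast
qed

end

section \<open>Triangle-freeness from a pair at distance 4\<close>

locale amply = sgraph +
  fixes m lam :: nat
  assumes card_N: "x \<in> V \<Longrightarrow> card (N x) = 2 * m + 1"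
    and m_ge: "2 \<le> m"
    and card_lam: "E x y \<Longrightarrow> card (N x \<inter> N y) = lam"
    and card_mu: "x \<noteq> y \<Longrightarrow> \<not> E x y \<Longrightarrow> N x \<inter> N y \<noteq> {} \<Longrightarrow> card (N x \<inter> N y) = m"
begin

text \<open>\<open>N a\<close> contains \<open>x\<close>, the \<open>lam\<close> common neighbours
  of \<open>a\<close> and \<open>x\<close>, and T, hence |T| <= 2m - lam. The sets
  \<open>N a \<inter> N b\<close> and \<open>N a \<inter> N b'\<close> are m-subsets of T, so they
  meet in at least \<open>lam\<close> vertices; together with \<open>y\<close> this is one common
  neighbour too many for adjacent \<open>b\<close>, \<open>b'\<close>.\<close>

lemma no_edge_in_far_neighbourhood:
  assumes far: "far x y" and a: "E x a" and b: "E y b" "N a \<inter> N b \<noteq> {}"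
    and b': "E y b'" "N a \<inter> N b' \<noteq> {}"
  shows "\<not> E b b'"
proof
  assume bb': "E b b'"
  define T where "T = N a \<inter> M x y"
  have [simp]: "finite T" by (simp add: T_def)
  have card_T: "card (N a \<inter> N c) = m" "N a \<inter> N c \<subseteq> T"
    if "E y c" "N a \<inter> N c \<noteq> {}" for c
  proof -
    have "a \<noteq> c" "\<not> E a c" using far a that(1) unfolding far_iff by auto
    then show "card (N a \<inter> N c) = m" using card_mu that by blast
    show "N a \<inter> N c \<subseteq> T" unfolding T_def using a that(1) by (auto simp: M_iff)
  qed
  have dis: "x \<notin> M x y" "N x \<inter> M x y = {}"
    using far E_sym unfolding far_iff disjoint_iff M_iff N_iff by blast+
  have "card (insert x ((N a \<inter> N x) \<union> T)) = 1 + (lam + card T)"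
    using dis card_lam[OF E_sym[OF a]] E_irrefl
    by (subst card_insert_disjoint card_Un_disjoint; auto simp: T_def)+
  moreover have "card (insert x ((N a \<inter> N x) \<union> T)) \<le> card (N a)"
    using a by (intro card_mono) (auto simp: T_def E_sym)
  ultimately have T_le: "lam + card T \<le> 2 * m"
    using card_N E_in_V a by fastforce
  have "card ((N a \<inter> N b) \<union> (N a \<inter> N b')) \<le> card T"
    using card_T b b' by (intro card_mono) auto
  moreover have "card ((N a \<inter> N b) \<union> (N a \<inter> N b')) + card ((N a \<inter> N b) \<inter> (N a \<inter> N b')) = 2 * m"
    using card_Un_Int[of "N a \<inter> N b" "N a \<inter> N b'"] card_T b b' by simp
  moreover have "card (insert y ((N a \<inter> N b) \<inter> (N a \<inter> N b'))) \<le> card (N b \<inter> N b')"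
    using b b' by (intro card_mono) (auto intro: E_sym)
  moreover have "y \<notin> N a" using far a E_sym[of a y] by (auto simp: far_iff)
  ultimately show False using T_le card_lam[OF bb'] by simp
qed

text \<open>For \<open>z\<close> in \<open>M x y\<close> and \<open>b\<close> in
  \<open>N z \<inter> N y\<close>, a common neighbour of \<open>z\<close> and \<open>b\<close>
  cannot lie in \<open>N x\<close> (the pair is far) nor in \<open>N y\<close> (previous lemma), so
  it is the left-over neighbour \<open>e\<close>. Hence lam <= 1. If lam = 1, then \<open>e\<close>
  is adjacent to all m >= 2 such \<open>b\<close>, which are then common neighbours of the adjacent
  vertices \<open>z\<close> and \<open>e\<close>.\<close>

lemma lam_eq_0:
  assumes far: "far x y" and M: "M x y \<noteq> {}"
  shows "lam = 0"
proof -
  obtain z where z: "z \<in> M x y" using M by blast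
  then obtain a where a: "E z a" "E x a" by (auto simp: M_iff intro: E_sym)
  have zx: "z \<noteq> x" "\<not> E z x" "z \<noteq> y" "\<not> E z y"
    using z far E_sym unfolding far_iff M_iff by blast+
  have cards: "card (N z \<inter> N x) = m" "card (N z \<inter> N y) = m"
    using z zx card_mu unfolding M_def by auto
  have dis: "(N z \<inter> N x) \<inter> (N z \<inter> N y) = {}"
    using far by (auto simp: far_def)
  have "z \<in> V" using z by (auto simp: M_def)
  then have "card (N z - (N z \<inter> N x \<union> N z \<inter> N y)) = 1"
    using cards card_N[of z] dis
    by (subst card_Diff_subset) (auto simp: card_Un_disjoint)
  then obtain e where e: "N z - (N z \<inter> N x \<union> N z \<inter> N y) = {e}"
    using card_1_singletonE by blast
  have sub: "N z \<inter> N b \<subseteq> {e}" if b: "b \<in> N z \<inter> N y" for b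
  proof
    fix c assume c: "c \<in> N z \<inter> N b"
    have "c \<notin> N x" using far b c by (auto simp: far_iff intro: E_sym)
    moreover have "c \<notin> N y"
    proof
      assume "c \<in> N y"
      moreover have "z \<in> N a \<inter> N b" "z \<in> N a \<inter> N c" using a b c by (auto intro: E_sym)
      then have "N a \<inter> N b \<noteq> {}" "N a \<inter> N c \<noteq> {}" by blast+
      ultimately show False
        using no_edge_in_far_neighbourhood[OF far a(2), of b c] b c by auto
    qed
    ultimately show "c \<in> {e}" using c e by blast
  qed
  have "lam \<le> 1"
  proof -
    obtain b where "b \<in> N z \<inter> N y" using z unfolding M_def by blast
    then show ?thesis using sub[of b] card_lam[of z b] card_mono[of "{e}" "N z \<inter> N b"] by auto
  qed
  moreover have "lam \<noteq> 1"
  proof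
    assume l: "lam = 1"
    have "e \<in> N b" if b: "b \<in> N z \<inter> N y" for b
    proof -
      have "card (N z \<inter> N b) = 1" using card_lam[of z b] b l by simp
      then have "N z \<inter> N b \<noteq> {}" by force
      then show ?thesis using sub[OF b] by blast
    qed
    then have "b \<in> N e" if "b \<in> N z \<inter> N y" for b using that E_sym[of b e] by simp
    then have "N z \<inter> N y \<subseteq> N z \<inter> N e" by blast
    then have le: "m \<le> card (N z \<inter> N e)" using cards(2) by (metis card_mono finite_N finite_Int)
    have "e \<in> N z - (N z \<inter> N x \<union> N z \<inter> N y)" unfolding e by (rule insertI1)
    then have "E z e" by simp
    then have "card (N z \<inter> N e) = 1" using card_lam l by metis
    then show False using m_ge le by linarith
  qed
  ultimately show ?thesis by simp
qed

end

section \<open>Vertices at distance 2 from both ends of a far pair\<close>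

text \<open>The setting after lam = 0. Distinct vertices with a common neighbour are now never
  adjacent, so \<open>card_mu\<close> speaks of the common neighbour alone. Connectivity takes the
  form of an induction principle for sets closed under adjacency, and \<open>far_meet\<close> is the
  trace of the diameter.\<close>

locale tfree = sgraph +
  fixes m :: nat
  assumes card_N: "x \<in> V \<Longrightarrow> card (N x) = 2 * m + 1"
    and m_ge: "2 \<le> m"
    and no_triangle: "E x y \<Longrightarrow> E y z \<Longrightarrow> \<not> E x z"
    and card_mu: "x \<noteq> y \<Longrightarrow> E x z \<Longrightarrow> E y z \<Longrightarrow> card (N x \<inter> N y) = m"
    and connected: "x \<in> V \<Longrightarrow> x \<in> U \<Longrightarrow> (\<And>u v. u \<in> U \<Longrightarrow> E u v \<Longrightarrow> v \<in> U) \<Longrightarrow> V \<subseteq> U"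
    and far_meet: "far x y \<Longrightarrow> M x y \<noteq> {}"
begin

text \<open>The edges between \<open>N x\<close> and \<open>G2 x\<close> number k (k - 1) = k * 2m
  from one side and m |G2| from the other.\<close>

lemma card_G2:
  assumes x: "x \<in> V"
  shows "card (G2 x) = 2 * (2 * m + 1)"
proof -
  have "N a \<inter> G2 x = N a - {x}" if "E x a" for a
    using that by (auto simp: G2_iff)
  then have "card (N a \<inter> G2 x) = 2 * m" if "E x a" for a
    using that card_N[of a] E_in_V E_sym[OF that] by simp
  then have "(\<Sum>a\<in>N x. card (N a \<inter> G2 x)) = (2 * m + 1) * (2 * m)"
    using card_N[OF x] by simp
  moreover have "card (N z \<inter> N x) = m" if "z \<in> G2 x" for z
    using that card_mu E_sym unfolding G2_iff by blast
  then have "(\<Sum>z\<in>G2 x. card (N z \<inter> N x)) = card (G2 x) * m"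
    by simp
  ultimately have "card (G2 x) * m = (2 * (2 * m + 1)) * m"
    using card_edges_commute[of "N x" "G2 x"] by (simp add: mult_ac)
  then show ?thesis using m_ge by (metis mult_cancel2 not_numeral_le_zero)
qed

text \<open>The left-over neighbour e(z); meaningful for \<open>z\<close> in \<open>M x y\<close> of
  a far pair, where the set is a singleton.\<close>

definition ee :: "'a \<Rightarrow> 'a \<Rightarrow> 'a \<Rightarrow> 'a" where
  "ee x y z = the_elem (N z - N x - N y)"

lemma ee_sym: "ee x y z = ee y x z"
  unfolding ee_def by (simp add: Diff_eq Int_ac)

definition W :: "'a \<Rightarrow> 'a \<Rightarrow> 'a set" where
  "W x y = G2 x - M x y"

end

locale far_pair = tfree +
  fixes x y :: 'a
  assumes far: "far x y"
begin

lemma xV: "x \<in> V" and yV: "y \<in> V" and xy_neq: "x \<noteq> y" and no_common: "E x a \<Longrightarrow> \<not> E y a"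
  and no_path3: "E x a \<Longrightarrow> E y b \<Longrightarrow> \<not> E a b" and not_adjacent: "\<not> E x y" "\<not> E y x"
  using far by (auto simp: far_iff intro: E_sym)

lemma far_pair_swap: "far_pair V E m y x"
  by unfold_locales (rule far_sym[OF far])

lemma M_apart:
  assumes "z \<in> M x y"
  shows "z \<in> V" "z \<noteq> x" "z \<noteq> y" "\<not> E x z" "\<not> E y z" "\<not> E z x" "\<not> E z y"
proof -
  show "z \<in> V" using assms E_in_V(2) unfolding M_iff by blast
  show "z \<noteq> x" "z \<noteq> y" "\<not> E x z" "\<not> E y z" "\<not> E z x" "\<not> E z y"
    using assms no_common no_path3 E_sym unfolding M_iff by blast+
qed

lemma card_A: "z \<in> M x y \<Longrightarrow> card (N z \<inter> N x) = m"
  and card_B: "z \<in> M x y \<Longrightarrow> card (N z \<inter> N y) = m"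
  using M_apart card_mu E_sym unfolding M_iff by blast+

lemma M_ends: "z \<in> M x y \<Longrightarrow> \<exists>a. E x a \<and> E a z" "z \<in> M x y \<Longrightarrow> \<exists>b. E y b \<and> E b z"
  unfolding M_iff by blast+

lemma M_I: "E x a \<Longrightarrow> E a z \<Longrightarrow> E z b \<Longrightarrow> E b y \<Longrightarrow> z \<in> M x y"
  unfolding M_iff using E_sym by blast

lemma M_subset_G2: "M x y \<subseteq> G2 x"
  using M_apart(2) unfolding subset_iff G2_iff M_iff by blast

lemma ee:
  assumes z: "z \<in> M x y"
  shows "N z - N x - N y = {ee x y z}"
proof -
  have "N z - N x - N y = N z - (N z \<inter> N x \<union> N z \<inter> N y)" by auto
  moreover have "(N z \<inter> N x) \<inter> (N z \<inter> N y) = {}" using no_common by auto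
  then have "card (N z \<inter> N x \<union> N z \<inter> N y) = 2 * m"
    using card_A[OF z] card_B[OF z] by (simp add: card_Un_disjoint)
  ultimately have "card (N z - N x - N y) = 1"
    using card_N[OF M_apart(1)[OF z]] card_Diff_subset[of "N z \<inter> N x \<union> N z \<inter> N y" "N z"] by simp
  then obtain e where "N z - N x - N y = {e}" by (rule card_1_singletonE)
  then show ?thesis by (simp add: ee_def)
qed

lemma eeD:
  assumes z: "z \<in> M x y"
  shows "E z (ee x y z)" "E (ee x y z) z" "\<not> E x (ee x y z)" "\<not> E y (ee x y z)"
proof -
  have "ee x y z \<in> N z - N x - N y" using ee[OF z] by simp
  then show "E z (ee x y z)" "E (ee x y z) z" "\<not> E x (ee x y z)" "\<not> E y (ee x y z)"
    by (auto intro: E_sym)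
qed

lemma ee_unique:
  assumes z: "z \<in> M x y" "E z e" "\<not> E x e" "\<not> E y e"
  shows "ee x y z = e"
proof -
  have "e \<in> N z - N x - N y" using z by simp
  then show ?thesis unfolding ee[OF z(1)] by simp
qed

text \<open>Otherwise \<open>z\<close> and \<open>e\<close> are each other's left-over neighbour.
  Some \<open>a\<close> in \<open>N x\<close> is adjacent to \<open>z\<close>, so \<open>a\<close>
  and \<open>e\<close> have m >= 2 common neighbours. None of them is adjacent to \<open>x\<close>
  (triangle) or to \<open>y\<close> (path of length 3), so each is the left-over neighbour of
  \<open>e\<close>, which is \<open>z\<close> alone.\<close>

lemma ee_notin_M:
  assumes z: "z \<in> M x y"
  shows "ee x y z \<notin> M x y"
proof
  define e where "e = ee x y z"
  assume "ee x y z \<in> M x y"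
  then have e: "e \<in> M x y" by (simp add: e_def)
  note ez = eeD[OF z, folded e_def]
  have eez: "ee x y e = z" using ez M_apart[OF z] by (intro ee_unique[OF e]) auto
  obtain a where a: "E x a" "E a z" using M_ends[OF z] by blast
  have "a \<noteq> e" using a ez by auto
  then have "card (N a \<inter> N e) = m" using card_mu[of a e z] a(2) ez(2) by blast
  moreover have "N a \<inter> N e \<subseteq> {z}"
  proof
    fix u assume u: "u \<in> N a \<inter> N e"
    have "\<not> E x u" using a u no_triangle by auto
    moreover have "\<not> E y u" using a u no_path3 by auto
    ultimately have "ee x y e = u" using ee_unique[OF e, of u] u by simp
    then show "u \<in> {z}" using eez by simp
  qed
  ultimately show False using m_ge card_mono[of "{z}" "N a \<inter> N e"] by simp
qed

lemma W_iff: "w \<in> W x y \<longleftrightarrow> w \<in> G2 x \<and> N w \<inter> N y = {}"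
  unfolding W_def disjoint_iff N_iff by (auto simp: M_iff G2_iff intro: E_sym)

lemma N_first:
  assumes a: "E x a"
  shows "N a = {x} \<union> (N a \<inter> M x y) \<union> (N a \<inter> W x y)" "x \<notin> M x y" "x \<notin> W x y" "M x y \<inter> W x y = {}"
proof -
  show "x \<notin> M x y" "x \<notin> W x y" "M x y \<inter> W x y = {}"
    using M_apart by (auto simp: W_def G2_iff)
  show "N a = {x} \<union> (N a \<inter> M x y) \<union> (N a \<inter> W x y)"
    using assms by (auto simp: W_def G2_iff intro: E_sym)
qed

lemma card_first:
  assumes a: "E x a"
  shows "card (N a \<inter> M x y) + card (N a \<inter> W x y) = 2 * m"
proof -
  have "card (N a) = 1 + (card (N a \<inter> M x y) + card (N a \<inter> W x y))"
    using N_first(2-)[OF a]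
    by (subst N_first(1)[OF a]) (subst card_Un_disjoint; auto)+
  then show ?thesis using card_N[of a] E_in_V(2)[OF a] by simp
qed

lemma card_W_first: "w \<in> W x y \<Longrightarrow> card (N w \<inter> N x) = m"
  using card_mu[of w x] E_sym unfolding W_iff G2_iff by blast

text \<open>Between T = \<open>N a \<inter> M x y\<close> and the set S of those \<open>b\<close> in
  \<open>N y\<close> that share a neighbour with \<open>a\<close>, both sides have degree m, so |T|
  = |S| >= m. With equality T and S would be completely joined, and two vertices of T would have
  \<open>a\<close> and all of S in common, m + 1 vertices.\<close>

lemma T_lower:
  assumes a: "E x a" and ne: "N a \<inter> M x y \<noteq> {}"
  shows "m + 1 \<le> card (N a \<inter> M x y)"
proof -
  define T where "T = N a \<inter> M x y"
  define S where "S = {b \<in> N y. N a \<inter> N b \<noteq> {}}"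
  have fin [simp]: "finite T" "finite S"
    using finite_subset[of S "N y"] by (auto simp: T_def S_def simp del: N_iff)
  have S1: "card (N b \<inter> T) = m" if b: "b \<in> S" for b
  proof -
    have "N b \<inter> T = N a \<inter> N b"
      using b a unfolding T_def S_def by (auto simp: M_iff)
    moreover have "a \<noteq> b" using b a no_common unfolding S_def by auto
    ultimately show ?thesis using b card_mu[of a b] unfolding S_def by auto
  qed
  have T1: "N z \<inter> S = N z \<inter> N y" if "z \<in> T" for z
    using that E_sym unfolding T_def S_def disjoint_iff N_iff by fastforce
  have T2: "card (N z \<inter> N y) = m" if "z \<in> T" for z
    using that card_B unfolding T_def by blast
  have "card T * m = card S * m"
    using card_edges_commute[OF fin] S1 T1 T2 by simp
  then have TS: "card T = card S" using m_ge by simp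
  obtain z where z: "z \<in> T" using ne unfolding T_def by blast
  have "N z \<inter> N y \<noteq> {}" using T2[OF z] m_ge by auto
  then obtain b where b: "b \<in> S" using T1[OF z] by blast
  have mT: "m \<le> card T" by (metis S1[OF b] card_mono fin(1) Int_lower2)
  have "card T \<noteq> m"
  proof
    assume Tm: "card T = m"
    then have Sm: "card S = m" using TS by simp
    have sub: "S \<subseteq> N z" if "z \<in> T" for z
    proof -
      have "card (N z \<inter> S) = card S" using T1[OF that] T2[OF that] Sm by simp
      then have "N z \<inter> S = S" using card_subset_eq[OF fin(2), of "N z \<inter> S"] by blast
      then show ?thesis by blast
    qed
    have "T \<noteq> {z}" using Tm m_ge by force
    then obtain z' where z': "z' \<in> T" "z' \<noteq> z" using z by blast
    have "card (N z \<inter> N z') = m"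
      using z z' card_mu[of z z' a] E_sym unfolding T_def Int_iff N_iff by blast
    moreover have "insert a S \<subseteq> N z \<inter> N z'"
      using sub[OF z] sub[OF z'(1)] z z' by (auto simp: T_def intro: E_sym)
    moreover have "a \<notin> S" using a no_common unfolding S_def by auto
    ultimately show False using card_mono[of "N z \<inter> N z'" "insert a S"] Sm by simp
  qed
  then show ?thesis using mT by (simp add: T_def)
qed

lemma W_adjacent_count:
  assumes a: "E x a" and w: "w \<in> W x y" "E a w" and z: "z \<in> M x y" "E a z"
  shows "N w \<inter> N z \<subseteq> insert (ee x y z) (N z \<inter> (N w \<inter> N x))" "card (N w \<inter> N z) = m"
proof -
  have "w \<noteq> z" using w z unfolding W_def by auto
  then show "card (N w \<inter> N z) = m" using card_mu[of w z a] w z by (auto intro: E_sym)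
  have "N w \<inter> N y = {}" using w W_iff by blast
  then show "N w \<inter> N z \<subseteq> insert (ee x y z) (N z \<inter> (N w \<inter> N x))"
    using ee[OF z(1)] by blast
qed

text \<open>Let \<open>w\<close> be in \<open>N a \<inter> W x y\<close> and A its m - 1 other
  neighbours in \<open>N x\<close>. A vertex \<open>z\<close> of T shares m vertices with
  \<open>w\<close>: possibly \<open>a\<close>, possibly \<open>ee x y z\<close>, and so at least m -
  2 from A. A vertex of A shares \<open>x\<close> and \<open>w\<close> with \<open>a\<close>, so it
  has at most m - 2 neighbours in T. Thus |T| (m - 2) <= (m - 1) (m - 2), and cancelling m - 2 > 0
  contradicts \<open>T_lower\<close>.\<close>

lemma O_empty:
  assumes m3: "3 \<le> m" and a: "E x a" and ne: "N a \<inter> M x y \<noteq> {}"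
  shows "N a \<inter> W x y = {}"
proof (rule ccontr)
  assume "N a \<inter> W x y \<noteq> {}"
  then obtain w where w: "w \<in> W x y" "E a w" by auto
  define T where "T = N a \<inter> M x y"
  define A where "A = N w \<inter> N x - {a}"
  have fin: "finite T" "finite A" by (auto simp: T_def A_def)
  have aA: "a \<in> N w \<inter> N x" using a w by (auto intro: E_sym)
  then have cA: "card A = m - 1" using card_W_first[OF w(1)] by (simp add: A_def)
  have lower: "m - 2 \<le> card (N z \<inter> A)" if z: "z \<in> T" for z
  proof -
    have zM: "z \<in> M x y" "E a z" using z by (auto simp: T_def)
    have "m \<le> card (insert (ee x y z) (insert a (N z \<inter> A)))"
      unfolding W_adjacent_count(2)[OF a w zM, symmetric]
      using W_adjacent_count(1)[OF a w zM] by (intro card_mono) (auto simp: A_def)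
    also have "\<dots> \<le> Suc (Suc (card (N z \<inter> A)))"
      by (simp add: card_insert_if)
    finally show ?thesis by simp
  qed
  have upper: "card (N p \<inter> T) \<le> m - 2" if p: "p \<in> A" for p
  proof -
    have px: "E x p" "E w p" "p \<noteq> a" using p by (auto simp: A_def)
    have "card (N p \<inter> N a) = m" using card_mu[of p a x] px a by (auto intro: E_sym)
    moreover have "N p \<inter> T \<subseteq> N p \<inter> N a - {x, w}"
      using w M_apart(2) unfolding T_def W_def by auto
    moreover have "{x, w} \<subseteq> N p \<inter> N a" using px w a by (auto intro: E_sym)
    moreover have "x \<noteq> w" using w by (auto simp: W_def G2_iff)
    ultimately show ?thesis
      using card_mono[of "N p \<inter> N a - {x, w}" "N p \<inter> T"] by (simp add: card_Diff_subset)
  qed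
  have "card T * (m - 2) \<le> (\<Sum>z\<in>T. card (N z \<inter> A))"
    using sum_mono[of T "\<lambda>_. m - 2"] lower by simp
  also have "\<dots> = (\<Sum>p\<in>A. card (N p \<inter> T))" by (rule card_edges_commute[OF fin])
  also have "\<dots> \<le> (m - 1) * (m - 2)"
    using sum_mono[of A _ "\<lambda>_. m - 2"] upper cA by simp
  finally have "card T \<le> m - 1" using m3 by simp
  then show False using T_lower[OF a ne] m3 by (simp add: T_def)
qed

text \<open>A vertex of \<open>W x y\<close> hangs on some \<open>a\<close> in \<open>N x\<close>
  that, by \<open>O\<close>, has no neighbour in \<open>M x y\<close>. A neighbour \<open>p\<close>
  of \<open>x\<close> that does reach \<open>M x y\<close> shares with \<open>a\<close> a vertex
  other than \<open>x\<close>; that vertex is in \<open>W x y\<close>, so \<open>p\<close> violates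
  \<open>O\<close>.\<close>

lemma W_empty:
  assumes "M x y \<noteq> {}" and O: "\<And>a. E x a \<Longrightarrow> N a \<inter> M x y \<noteq> {} \<Longrightarrow> N a \<inter> W x y = {}"
  shows "W x y = {}"
proof (rule ccontr)
  assume "W x y \<noteq> {}"
  then obtain w a where w: "w \<in> W x y" "E x a" "E a w"
    unfolding W_def G2_iff ex_in_conv[symmetric] Diff_iff by blast
  then have "N a \<inter> W x y \<noteq> {}" by (auto simp: W_def)
  then have a: "N a \<inter> M x y = {}" using O w(2) by blast
  obtain z where z: "z \<in> M x y" using assms(1) by blast
  then obtain p where p: "E x p" "E p z" using M_ends by blast
  have "p \<noteq> a" using a p z by auto
  then have "card (N p \<inter> N a) = m" using card_mu[of p a x] p w by (auto intro: E_sym)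
  then have "\<not> N p \<inter> N a \<subseteq> {x}" using m_ge card_mono[of "{x}" "N p \<inter> N a"] by auto
  then obtain u where "u \<in> N p \<inter> N a" "u \<noteq> x" by blast
  then have u: "E p u" "E a u" "u \<noteq> x" by auto
  have "u \<in> W x y" using N_first(1)[OF w(2)] a u by auto
  moreover have "N p \<inter> M x y \<noteq> {}" using p z by auto
  ultimately show False using O[OF p(1)] u by auto
qed

end

section \<open>Vertices with a common left-over neighbour\<close>

context far_pair
begin

text \<open>D consists of the vertices with the same left-over neighbour \<open>e\<close> as
  \<open>z\<close>. Each other member shares with \<open>z\<close> the vertex \<open>e\<close> and
  hence exactly m - 1 vertices of \<open>N x\<close> or \<open>N y\<close>. The right side counts
  the same incidences from those vertices; each \<open>- 1\<close> removes \<open>z\<close>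
  itself.\<close>

lemma common_ee_count:
  assumes z: "z \<in> M x y" and D_def: "D = N (ee x y z) \<inter> M x y"
  shows "(card D - 1) * (m - 1) =
    (\<Sum>a\<in>N z \<inter> N x. card (N a \<inter> D) - 1) + (\<Sum>b\<in>N z \<inter> N y. card (N b \<inter> D) - 1)"
proof -
  define e where "e = ee x y z"
  have fin: "finite D" "finite (D - {z})" "finite (N z \<inter> N x)" "finite (N z \<inter> N y)"
    by (auto simp: D_def)
  have zD: "z \<in> D" using z eeD[OF z] by (simp add: D_def)
  have common: "card (N z' \<inter> (N z \<inter> N x)) + card (N z' \<inter> (N z \<inter> N y)) = m - 1"
    if z': "z' \<in> D - {z}" for z'
  proof -
    have ez: "E z e" "\<not> E x e" "\<not> E y e" using eeD[OF z] by (auto simp: e_def)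
    have ez': "E z' e" using z' E_sym by (simp add: D_def e_def)
    have "N z \<inter> N z' = insert e ((N z' \<inter> (N z \<inter> N x)) \<union> (N z' \<inter> (N z \<inter> N y)))"
    proof
      show "N z \<inter> N z' \<subseteq> insert e ((N z' \<inter> (N z \<inter> N x)) \<union> (N z' \<inter> (N z \<inter> N y)))"
        using ee[OF z] unfolding e_def by blast
      show "insert e ((N z' \<inter> (N z \<inter> N x)) \<union> (N z' \<inter> (N z \<inter> N y))) \<subseteq> N z \<inter> N z'"
        using ez ez' by auto
    qed
    moreover have "e \<notin> (N z' \<inter> (N z \<inter> N x)) \<union> (N z' \<inter> (N z \<inter> N y))" using ez by simp
    moreover have "(N z' \<inter> (N z \<inter> N x)) \<inter> (N z' \<inter> (N z \<inter> N y)) = {}"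
      using no_common by auto
    ultimately have "card (N z \<inter> N z') = Suc (card (N z' \<inter> (N z \<inter> N x)) + card (N z' \<inter> (N z \<inter> N y)))"
      by (simp add: card_Un_disjoint)
    moreover have "card (N z \<inter> N z') = m" using card_mu[of z z' e] ez ez' z' by auto
    ultimately show ?thesis by simp
  qed
  have drop: "card (N a \<inter> (D - {z})) = card (N a \<inter> D) - 1" if "E z a" for a
  proof -
    have "N a \<inter> (D - {z}) = (N a \<inter> D) - {z}" by auto
    moreover have "z \<in> N a \<inter> D" using zD E_sym[OF that] by simp
    ultimately show ?thesis by simp
  qed
  have "(\<Sum>z'\<in>D - {z}. card (N z' \<inter> (N z \<inter> N x)) + card (N z' \<inter> (N z \<inter> N y))) = (\<Sum>z'\<in>D - {z}. m - 1)"
    using common by (intro sum.cong refl)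
  also have "\<dots> = (card D - 1) * (m - 1)" using zD by simp
  finally have "(card D - 1) * (m - 1) =
    (\<Sum>a\<in>N z \<inter> N x. card (N a \<inter> (D - {z}))) + (\<Sum>b\<in>N z \<inter> N y. card (N b \<inter> (D - {z})))"
    unfolding sum.distrib
    using card_edges_commute[OF fin(2,3)] card_edges_commute[OF fin(2,4)] by simp
  also have "(\<Sum>a\<in>N z \<inter> N x. card (N a \<inter> (D - {z}))) = (\<Sum>a\<in>N z \<inter> N x. card (N a \<inter> D) - 1)"
    using drop by (intro sum.cong) auto
  also have "(\<Sum>a\<in>N z \<inter> N y. card (N a \<inter> (D - {z}))) = (\<Sum>a\<in>N z \<inter> N y. card (N a \<inter> D) - 1)"
    using drop by (intro sum.cong) auto
  finally show ?thesis .
qed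

lemma card_M_W: "card (M x y) + card (W x y) = 2 * (2 * m + 1)"
proof -
  have "card (M x y) + card (W x y) = card (G2 x)"
    unfolding W_def using M_subset_G2 by (metis card_Diff_subset card_mono finite_G2 finite_M le_add_diff_inverse)
  then show ?thesis using card_G2[OF xV] by simp
qed

text \<open>\<open>M\<close> is symmetric and both second neighbourhoods have 2k vertices, so their
  remainders have equal size.\<close>

lemma card_W_sym: "card (W x y) = card (W y x)"
  using card_M_W far_pair.card_M_W[OF far_pair_swap] M_sym[of x y] by simp

lemma ee_image_notin:
  assumes "e \<in> ee x y ` M x y"
  shows "\<not> E x e" "\<not> E y e" "e \<noteq> x" "e \<noteq> y"
proof -
  obtain z where z: "z \<in> M x y" "e = ee x y z" using assms by blast
  then show "\<not> E x e" "\<not> E y e" "e \<noteq> x" "e \<noteq> y"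
    using eeD[OF z(1)] M_apart[OF z(1)] by auto
qed

lemma N_ee_image:
  assumes z: "z \<in> M x y"
  shows "N z \<inter> ee x y ` M x y = {ee x y z}"
proof
  show "{ee x y z} \<subseteq> N z \<inter> ee x y ` M x y" using z eeD(1)[OF z] by simp
  show "N z \<inter> ee x y ` M x y \<subseteq> {ee x y z}"
    using ee_unique[OF z, symmetric] ee_image_notin(1,2) by auto
qed

text \<open>Every \<open>z\<close> in \<open>M x y\<close> sees exactly one vertex of the image, so
  the sets \<open>N e \<inter> M x y\<close> partition \<open>M x y\<close>.\<close>

lemma sum_D:
  "(\<Sum>e\<in>ee x y ` M x y. card (N e \<inter> M x y)) = card (M x y)"
proof -
  have "(\<Sum>e\<in>ee x y ` M x y. card (N e \<inter> M x y)) = (\<Sum>z\<in>M x y. card (N z \<inter> ee x y ` M x y))"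
    by (rule card_edges_commute) auto
  then show ?thesis using N_ee_image by simp
qed

end

section \<open>The bipartite case\<close>

locale good_pair = far_pair +
  assumes W_x: "W x y = {}"
begin

lemma W_y: "W y x = {}"
proof -
  have "card (W y x) = 0" using card_W_sym W_x by simp
  moreover have "finite (W y x)" by (simp add: W_def)
  ultimately show ?thesis by simp
qed

lemma good_pair_swap: "good_pair V E m y x"
  by (intro good_pair.intro far_pair_swap good_pair_axioms.intro W_y)

lemma M_eq_G2: "M x y = G2 x"
  using W_x M_subset_G2 unfolding W_def by blast

lemma N_x: "E x a \<Longrightarrow> E a u \<Longrightarrow> u = x \<or> u \<in> M x y"
  unfolding M_eq_G2 G2_iff by blast

lemma card_N_x: "E x a \<Longrightarrow> card (N a \<inter> M x y) = 2 * m"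
  using card_first W_x by simp

lemma first_ee:
  assumes z: "z \<in> M x y" and a: "E x a" "E z a"
  shows "card (N a \<inter> (N (ee x y z) \<inter> M x y)) = m"
proof -
  have "x \<notin> N (ee x y z)" using eeD[OF z] E_sym[of "ee x y z" x] by auto
  then have "N a \<inter> (N (ee x y z) \<inter> M x y) = N a \<inter> N (ee x y z)"
    using N_x[OF a(1)] unfolding set_eq_iff Int_iff N_iff by blast
  moreover have "a \<noteq> ee x y z" using eeD[OF z] a by auto
  ultimately show ?thesis using card_mu[of a "ee x y z" z] a eeD[OF z] E_sym[of z a] by simp
qed

text \<open>With W empty each of the 2m terms in \<open>common_ee_count\<close> equals m - 1, so |D|
  - 1 = 2m and D has k elements, the whole neighbourhood of \<open>e\<close>.\<close>

lemma N_ee: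
  assumes z: "z \<in> M x y"
  shows "N (ee x y z) \<subseteq> M x y"
proof -
  define D where "D = N (ee x y z) \<inter> M x y"
  interpret s: good_pair V E m y x by (rule good_pair_swap)
  have 1: "card (N a \<inter> D) = m" if "a \<in> N z \<inter> N x" for a
    using first_ee[OF z] that by (simp add: D_def)
  have 2: "card (N b \<inter> D) = m" if "b \<in> N z \<inter> N y" for b
    using s.first_ee[of z b] z that M_sym[of x y] ee_sym[of x y z] by (simp add: D_def)
  have "(card D - 1) * (m - 1) = m * (m - 1) + m * (m - 1)"
    using common_ee_count[OF z D_def] 1 2 card_A[OF z] card_B[OF z] by simp
  then have "(card D - 1) * (m - 1) = (2 * m) * (m - 1)" by simp
  then have "card D - 1 = 2 * m" using m_ge unfolding mult_cancel2 by simp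
  moreover have "card (N (ee x y z)) = 2 * m + 1" using card_N eeD[OF z] E_in_V by blast
  ultimately have "card D = card (N (ee x y z))" using m_ge by simp
  then have "D = N (ee x y z)" by (intro card_subset_eq) (auto simp: D_def)
  then show ?thesis by (auto simp: D_def)
qed

definition F where "F = ee x y ` M x y"

lemma card_F: "card F = 2"
proof -
  have "card (N e \<inter> M x y) = 2 * m + 1" if e: "e \<in> F" for e
  proof -
    obtain z where z: "z \<in> M x y" "e = ee x y z" using e F_def by blast
    then have "N e \<inter> M x y = N e" using N_ee by blast
    then show ?thesis using card_N eeD[OF z(1)] E_in_V z(2) by metis
  qed
  then have "card F * (2 * m + 1) = card (M x y)" using sum_D by (simp add: F_def)
  also have "\<dots> = 2 * (2 * m + 1)" using card_M_W W_x by simp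
  finally show ?thesis unfolding mult_cancel2 by simp
qed

lemma F_N: "e \<in> F \<Longrightarrow> N e \<subseteq> M x y"
  using N_ee by (auto simp: F_def)

lemma F_notin: "e \<in> F \<Longrightarrow> \<not> E x e" "e \<in> F \<Longrightarrow> \<not> E y e" "e \<in> F \<Longrightarrow> e \<noteq> x" "e \<in> F \<Longrightarrow> e \<noteq> y"
  "e \<in> F \<Longrightarrow> e \<notin> M x y" "e \<in> F \<Longrightarrow> e \<in> V"
  using ee_image_notin ee_notin_M by (auto simp: F_def intro: E_in_V(2) eeD(1))

lemma xy_notin_F: "x \<notin> F" "y \<notin> F"
  using F_notin by blast+

lemma xy_notin_M: "x \<notin> M x y" "y \<notin> M x y"
  using M_apart by blast+

lemma N_M: "z \<in> M x y \<Longrightarrow> N z = (N z \<inter> N x) \<union> (N z \<inter> N y) \<union> {ee x y z}"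
  using ee by blast

text \<open>The union of the cells is closed under adjacency, so connectivity makes it
  everything.\<close>

lemma V_eq: "V = insert x (N x) \<union> M x y \<union> N y \<union> F \<union> {y}"
proof
  interpret s: good_pair V E m y x by (rule good_pair_swap)
  show "V \<subseteq> insert x (N x) \<union> M x y \<union> N y \<union> F \<union> {y}"
  proof (rule connected[OF xV])
    fix u v assume u: "u \<in> insert x (N x) \<union> M x y \<union> N y \<union> F \<union> {y}" and uv: "E u v"
    consider "u = x" | "E x u" | "u \<in> M x y" | "E y u" | "u \<in> F" | "u = y" using u by auto
    then show "v \<in> insert x (N x) \<union> M x y \<union> N y \<union> F \<union> {y}"
    proof cases
      case 2
      then have "v \<in> insert x (M x y)" using N_x uv by blast
      then show ?thesis by blast
    next
      case 3
      have "ee x y u \<in> F" using 3 by (simp add: F_def)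
      then show ?thesis using N_M[OF 3] uv N_iff[of v u] by blast
    next
      case 4
      then have "v \<in> insert y (M x y)" using s.N_x uv M_sym by blast
      then show ?thesis by blast
    next
      case 5
      then show ?thesis using F_N uv N_iff[of v u] by blast
    qed (use uv in auto)
  qed simp
  show "insert x (N x) \<union> M x y \<union> N y \<union> F \<union> {y} \<subseteq> V"
    using xV yV N_subset M_apart(1) F_notin(6) by blast
qed

lemma bipartition:
  assumes "E u v"
  shows "u \<in> {x, y} \<union> M x y \<longleftrightarrow> v \<notin> {x, y} \<union> M x y"
proof -
  interpret s: good_pair V E m y x by (rule good_pair_swap)
  have 1: "v \<notin> {x, y} \<union> M x y" if "u \<in> {x, y} \<union> M x y" "E u v" for u v
  proof -
    have "v \<in> N x \<union> N y \<union> F"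
      using that N_M[of u] N_iff[of v u] by (auto simp: F_def simp del: N_iff)
    then show ?thesis using F_notin M_apart(4,5) E_irrefl not_adjacent by auto
  qed
  have 2: "v \<in> {x, y} \<union> M x y" if "u \<in> N x \<union> N y \<union> F" "E u v" for u v
    using that N_x[of u v] s.N_x[of u v] subsetD[OF F_N, of u v] unfolding M_sym[of y x] by auto
  have "u \<in> {x, y} \<union> M x y \<or> u \<in> N x \<union> N y \<union> F"
    using V_eq E_in_V(1)[OF assms] by blast
  then show ?thesis using 1 2 assms by blast
qed

text \<open>The equal sizes of the two colour classes are what later gives a partner to the vertices
  of either class.\<close>

lemma card_parts:
  "card ({x, y} \<union> M x y) = 2 * (2 * m + 1) + 2"
  "card (V - ({x, y} \<union> M x y)) = 2 * (2 * m + 1) + 2"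
proof -
  have M: "card (M x y) = 2 * (2 * m + 1)" using card_M_W W_x by simp
  have "x \<notin> M x y" "y \<notin> M x y" using M_apart by auto
  then show "card ({x, y} \<union> M x y) = 2 * (2 * m + 1) + 2" using M xy_neq by simp
  have fin: "finite F" by (simp add: F_def)
  have "V - ({x, y} \<union> M x y) = N x \<union> N y \<union> F"
  proof -
    have "v \<in> V - ({x, y} \<union> M x y) \<longleftrightarrow> v \<in> N x \<union> N y \<union> F" for v
    proof -
      have "v \<in> V \<longleftrightarrow> v \<in> insert x (N x) \<union> M x y \<union> N y \<union> F \<union> {y}"
        by (rule arg_cong[OF V_eq])
      then show ?thesis using F_notin(5) xy_notin_F M_apart(4,5) E_irrefl not_adjacent by auto
    qed
    then show ?thesis by blast
  qed
  also have "card \<dots> = card (N x) + card (N y) + card F"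
    using F_notin no_common fin by (subst card_Un_disjoint; auto)+
  finally show "card (V - ({x, y} \<union> M x y)) = 2 * (2 * m + 1) + 2"
    using card_N xV yV card_F by simp
qed

text \<open>Vertices of \<open>N y\<close> and \<open>F\<close> have a neighbour in
  \<open>M x y\<close>, hence a walk of length 3 from \<open>x\<close>; the bipartition rules out a
  common neighbour with \<open>x\<close>. As the cells cover \<open>V\<close> and distances are
  unique, the inclusions are equalities.\<close>

lemma Gams:
  "Gam V E 1 x = N x" "Gam V E 2 x = M x y" "Gam V E 3 x = N y \<union> F" "Gam V E 4 x = {y}"
proof -
  interpret s: good_pair V E m y x by (rule good_pair_swap)
  show "Gam V E 1 x = N x" unfolding Gam_def dist_is_1 nbrs_def by simp
  have 3: "dist_is V E x v 3" if v: "v \<in> N y \<union> F" for v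
  proof -
    have ne: "v \<in> V" using v V_eq by blast
    have "\<exists>z. z \<in> M x y \<and> E v z"
    proof (cases "v \<in> F")
      case True
      have "N v \<noteq> {}" using card_N[OF ne] by force
      then show ?thesis using F_N[OF True] by auto
    next
      case False
      then have "E y v" using v by simp
      then have "card (N v \<inter> M x y) \<noteq> 0" using s.card_N_x M_sym m_ge by simp
      then have "N v \<inter> M x y \<noteq> {}" by force
      then show ?thesis by auto
    qed
    then obtain z where z: "z \<in> M x y" "E v z" by blast
    then obtain a where "E x a" "E a z" using M_ends by blast
    then have ex: "\<exists>a b. E x a \<and> E a b \<and> E b v" using z E_sym by blast
    have "v \<notin> {x, y} \<union> M x y" using v F_notin M_apart(4,5) E_irrefl not_adjacent by auto
    then have "u \<in> {x, y} \<union> M x y" if "E v u" for u using bipartition[OF that] by blast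
    moreover have "u \<notin> {x, y} \<union> M x y" if "E x u" for u using bipartition[OF that] by blast
    ultimately have "N x \<inter> N v = {}" unfolding disjoint_iff N_iff by blast
    moreover have "x \<noteq> v" "\<not> E x v" using v F_notin no_common E_irrefl not_adjacent by auto
    ultimately show ?thesis unfolding dist_is_3 using ex by blast
  qed
  have 4: "dist_is V E x y 4" unfolding dist_is_4 using far far_meet by blast
  have 0: "dist_is V E x x 0" unfolding dist_is_def walk_0 using xV by simp
  have 2: "dist_is V E x v 2 \<longleftrightarrow> v \<in> M x y" if "v \<notin> N x" for v
    unfolding dist_is_2 M_eq_G2 G2_iff disjoint_iff N_iff using that N_iff E_sym by blast
  have uniq: "i = j" if "dist_is V E x v i" "dist_is V E x v j" for v i j
    using that unfolding dist_is_def by (meson nat_neq_iff)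
  have 1: "dist_is V E x v 1 \<longleftrightarrow> v \<in> N x" for v unfolding dist_is_1 by simp
  have all: "v = x \<or> v \<in> N x \<or> v \<in> M x y \<or> v \<in> N y \<union> F \<or> v = y" if "v \<in> V" for v
    using that V_eq by blast
  have N1: "v \<notin> N x" if "v \<in> M x y" for v using M_apart(4)[OF that] by simp
  have sub: "N y \<union> F \<subseteq> V" "M x y \<subseteq> V" using V_eq by blast+
  have two: "dist_is V E x v 2" if "v \<in> M x y" for v using 2[OF N1[OF that]] that by blast
  have cls: "(i = 0 \<and> v = x) \<or> (i = 1 \<and> v \<in> N x) \<or> (i = 2 \<and> v \<in> M x y) \<or> (i = 3 \<and> v \<in> N y \<union> F) \<or> (i = 4 \<and> v = y)"
    if i: "dist_is V E x v i" and v: "v \<in> V" for v i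
  proof -
    consider "v = x" | "v \<in> N x" | "v \<in> M x y" | "v \<in> N y \<union> F" | "v = y" using all[OF v] by blast
    then show ?thesis
    proof cases
      case 1
      then show ?thesis using uniq[OF i] 0 by blast
    next
      case 2
      then show ?thesis using uniq[OF i] 1 by blast
    next
      case 3
      then show ?thesis using uniq[OF i] two by blast
    next
      case 4
      then show ?thesis using uniq[OF i] 3 by blast
    next
      case 5
      then show ?thesis using uniq[OF i] \<open>dist_is V E x y 4\<close> by blast
    qed
  qed
  have "v \<in> M x y" if "dist_is V E x v 2" "v \<in> V" for v using cls[OF that] by simp
  then show "Gam V E 2 x = M x y" unfolding Gam_def using two sub by blast
  have "v \<in> N y \<union> F" if "dist_is V E x v 3" "v \<in> V" for v using cls[OF that] by simp
  then show "Gam V E 3 x = N y \<union> F" unfolding Gam_def using 3 sub by blast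
  have "v = y" if "dist_is V E x v 4" "v \<in> V" for v using cls[OF that] by simp
  then show "Gam V E 4 x = {y}" unfolding Gam_def using 4 yV by blast
qed

end

section \<open>Quotient numbers of the partition\<close>

context good_pair
begin

lemma quotient_rows:
  fixes row :: "'a \<Rightarrow> nat list"
  defines "row \<equiv> \<lambda>u. map (\<lambda>C. card (N u \<inter> C)) [{x}, N x, M x y, N y, F, {y}]"
  shows "row x = [0, 2 * m + 1, 0, 0, 0, 0]"
    and "u \<in> N x \<Longrightarrow> row u = [1, 0, 2 * m, 0, 0, 0]"
    and "u \<in> M x y \<Longrightarrow> row u = [0, m, 0, m, 1, 0]"
    and "u \<in> N y \<Longrightarrow> row u = [0, 0, 2 * m, 0, 0, 1]"
    and "u \<in> F \<Longrightarrow> row u = [0, 0, 2 * m + 1, 0, 0, 0]"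
    and "row y = [0, 0, 0, 2 * m + 1, 0, 0]"
proof -
  interpret s: good_pair V E m y x by (rule good_pair_swap)
  have N_disj: "N u \<inter> C = {}" if "\<And>v. E u v \<Longrightarrow> v \<notin> C" for u C using that by auto
  \<comment> \<open>Membership in \<open>H\<close> is the colour; it yields the zero entries between
    cells of the same colour.\<close>
  define H where "H = {x, y} \<union> M x y"
  have H: "u \<in> H \<longleftrightarrow> v \<notin> H" if "E u v" for u v using bipartition[OF that] by (simp add: H_def)
  have HC: "{x} \<subseteq> H" "M x y \<subseteq> H" "{y} \<subseteq> H" "N x \<inter> H = {}" "N y \<inter> H = {}" "F \<inter> H = {}"
    using M_apart(4,5) E_irrefl not_adjacent F_notin(5) xy_notin_F by (auto simp: H_def)
  have even: "N u \<inter> {x} = {}" "N u \<inter> M x y = {}" "N u \<inter> {y} = {}" if "u \<in> H" for u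
    by (rule N_disj, use H that HC in blast)+
  have odd: "N u \<inter> N x = {}" "N u \<inter> N y = {}" "N u \<inter> F = {}" if "u \<notin> H" for u
    by (rule N_disj, use H that HC in blast)+
  have F_N_disj: "N x \<inter> F = {}" "N y \<inter> F = {}" "N x \<inter> N y = {}" "N y \<inter> N x = {}"
    using F_notin(1,2) no_common by auto
  have xH: "x \<in> H" "y \<in> H" by (simp_all add: H_def)
  show "row x = [0, 2 * m + 1, 0, 0, 0, 0]" "row y = [0, 0, 0, 2 * m + 1, 0, 0]"
    unfolding row_def using even[OF xH(1)] even[OF xH(2)] F_N_disj card_N xV yV by simp_all
  {
    assume u: "u \<in> N x"
    then have nH: "u \<notin> H" using HC by blast
    have "N u \<inter> {x} = {x}" using u E_sym[of x u] by simp
    moreover have "N u \<inter> {y} = {}" using u no_common E_sym[of u y] by auto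
    moreover have "card (N u \<inter> M x y) = 2 * m" using card_N_x u by simp
    ultimately show "row u = [1, 0, 2 * m, 0, 0, 0]" unfolding row_def using odd[OF nH] by simp
  }
  {
    assume u: "u \<in> N y"
    then have nH: "u \<notin> H" using HC by blast
    have "N u \<inter> {y} = {y}" using u E_sym[of y u] by simp
    moreover have "N u \<inter> {x} = {}" using u no_common E_sym[of u x] by auto
    moreover have "card (N u \<inter> M x y) = 2 * m" using s.card_N_x u M_sym by simp
    ultimately show "row u = [0, 0, 2 * m, 0, 0, 1]" unfolding row_def using odd[OF nH] by simp
  }
  {
    assume u: "u \<in> M x y"
    then have uH: "u \<in> H" by (simp add: H_def)
    show "row u = [0, m, 0, m, 1, 0]"
      unfolding row_def using even[OF uH] card_A[OF u] card_B[OF u] N_ee_image[OF u] by (simp add: F_def)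
  }
  {
    assume u: "u \<in> F"
    then have nH: "u \<notin> H" using HC by blast
    have "N u \<inter> M x y = N u" "N u \<inter> {x} = {}" "N u \<inter> {y} = {}" using F_N[OF u] xy_notin_M by blast+
    then show "row u = [0, 0, 2 * m + 1, 0, 0, 0]"
      unfolding row_def using odd[OF nH] card_N[OF F_notin(6)[OF u]] by simp
  }
qed

lemma equitable:
  "equitable_partition V E [{x}, N x, M x y, N y, F, {y}]
     [[0, 2 * m + 1, 0, 0, 0, 0], [1, 0, 2 * m, 0, 0, 0], [0, m, 0, m, 1, 0],
      [0, 0, 2 * m, 0, 0, 1], [0, 0, 2 * m + 1, 0, 0, 0], [0, 0, 0, 2 * m + 1, 0, 0]]"
  (is "equitable_partition V E ?C ?Q")
proof -
  let ?row = "\<lambda>u. map (\<lambda>C. card (N u \<inter> C)) ?C"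
  have six: "i < length ?C \<longleftrightarrow> i \<in> {0, 1, 2, 3, 4, 5}" for i by auto
  have rows: "?row u = ?Q ! i" if i: "i < length ?C" and u: "u \<in> ?C ! i" for i u
    using i[unfolded six] u quotient_rows by (elim insertE emptyE; simp)
  have cards: "card (N u \<inter> ?C ! j) = ?Q ! i ! j"
    if "i < length ?C" "j < length ?C" "u \<in> ?C ! i" for i j u
  proof -
    have "?Q ! i ! j = ?row u ! j" unfolding rows[OF that(1,3)] ..
    also have "\<dots> = card (N u \<inter> ?C ! j)" using that(2) by (rule nth_map)
    finally show ?thesis ..
  qed
  have "\<Union> (set ?C) = insert x (N x) \<union> M x y \<union> N y \<union> F \<union> {y}" by auto
  then have "\<Union> (set ?C) = V" unfolding V_eq[symmetric] .
  moreover have "\<forall>i<length ?C. \<forall>j<length ?C. i \<noteq> j \<longrightarrow> ?C ! i \<inter> ?C ! j = {}"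
  proof -
    have "x \<notin> N x" "y \<notin> N x" "x \<notin> N y" "y \<notin> N y" using E_irrefl not_adjacent by simp_all
    moreover have "N x \<inter> N y = {}" using no_common by auto
    moreover have "N x \<inter> M x y = {}" "N y \<inter> M x y = {}" using M_apart(4,5) by auto
    moreover have "N x \<inter> F = {}" "N y \<inter> F = {}" using F_notin(1,2) by auto
    moreover have "M x y \<inter> F = {}" using F_notin(5) by blast
    ultimately have lt: "?C ! i \<inter> ?C ! j = {}" if "i < length ?C" "j < i" for i j
      using that xy_notin_F xy_notin_M xy_neq unfolding six
      by (elim insertE emptyE; force simp: less_Suc_eq numeral_eq_Suc)
    show ?thesis
    proof (intro allI impI)
      fix i j assume "i < length ?C" "j < length ?C" "i \<noteq> j"
      then show "?C ! i \<inter> ?C ! j = {}"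
        using lt[of i j] lt[of j i] Int_commute[of "?C ! i" "?C ! j"] by (cases "j < i") auto
    qed
  qed
  moreover have "\<forall>i<length ?C. length (?Q ! i) = length ?C"
    unfolding six by simp
  moreover have "length ?Q = length ?C" by simp
  ultimately show ?thesis unfolding equitable_partition_def using cards by blast
qed

lemma partition:
  "\<exists>D3 D3'. D3 \<union> D3' = Gam V E 3 x \<and>
     map card [{x}, Gam V E 1 x, Gam V E 2 x, D3, D3', Gam V E 4 x]
       = [1, 2 * m + 1, 2 * (2 * m + 1), 2 * m + 1, 2, 1] \<and>
     equitable_partition V E [{x}, Gam V E 1 x, Gam V E 2 x, D3, D3', Gam V E 4 x]
       [[0, 2 * m + 1, 0, 0, 0, 0], [1, 0, 2 * m, 0, 0, 0], [0, m, 0, m, 1, 0],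
        [0, 0, 2 * m, 0, 0, 1], [0, 0, 2 * m + 1, 0, 0, 0], [0, 0, 0, 2 * m + 1, 0, 0]]"
proof -
  have "card (N x) = 2 * m + 1" "card (N y) = 2 * m + 1" using card_N xV yV by auto
  moreover have "card (M x y) = 2 * (2 * m + 1)" using card_M_W W_x by simp
  ultimately show ?thesis
    unfolding Gams using card_F equitable
    by (intro exI[of _ "N y"] exI[of _ F]) simp
qed

end

section \<open>From one far pair to every vertex\<close>

context tfree
begin

text \<open>For \<open>u\<close> in the colour class \<open>H\<close>, the set
  \<open>insert u (G2 u)\<close> lies in \<open>H\<close> and has one element fewer, so exactly one
  vertex of \<open>H\<close> is missed. The vertex \<open>y\<close> missed by \<open>x\<close> is
  far from \<open>x\<close>: odd distances are excluded by colour. A vertex \<open>w\<close> of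
  \<open>W x y\<close> would be missed by \<open>y\<close> together with \<open>x\<close>, forcing
  \<open>w = x\<close>.\<close>

lemma good_partner:
  assumes H: "H \<subseteq> V" "\<And>u v. E u v \<Longrightarrow> u \<in> H \<longleftrightarrow> v \<notin> H" "card H = 2 * (2 * m + 1) + 2" "x \<in> H"
  shows "\<exists>y. good_pair V E m x y"
proof -
  have G2_sub: "insert u (G2 u) \<subseteq> H" if "u \<in> H" for u
  proof
    fix v assume "v \<in> insert u (G2 u)"
    then consider "v = u" | a where "E u a" "E a v" unfolding insert_iff G2_iff by blast
    then show "v \<in> H" using that H(2) by cases blast+
  qed
  have one: "card (H - insert u (G2 u)) = 1" if u: "u \<in> H" for u
  proof -
    have "u \<notin> G2 u" by (simp add: G2_iff)
    then have "card (insert u (G2 u)) = 2 * (2 * m + 1) + 1"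
      using card_G2[of u] u H(1) by auto
    then show ?thesis using card_Diff_subset[OF _ G2_sub[OF u]] H(3) by simp
  qed
  obtain y where y: "H - insert x (G2 x) = {y}" using one[OF H(4)] by (rule card_1_singletonE)
  then have yH: "y \<in> H" "y \<noteq> x" "y \<notin> G2 x" by blast+
  have far: "far x y"
    unfolding far_iff
  proof (intro conjI allI impI)
    show "x \<in> V" "y \<in> V" "x \<noteq> y" using H(1,4) yH by blast+
    show "\<not> E x y" using H(2)[of x y] H(4) yH by blast
    show "\<not> E y a" if "E x a" for a
      using that yH(2,3) E_sym[of y a] unfolding G2_iff by blast
    show "\<not> E a b" if "E x a" "E y b" for a b
      using H(2)[OF that(1)] H(2)[OF that(2)] H(2)[of a b] H(4) yH(1) by blast
  qed
  then interpret far_pair V E m x y by unfold_locales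
  have "W x y = {}"
  proof (rule ccontr)
    assume "W x y \<noteq> {}"
    then obtain w where w: "w \<in> W x y" by blast
    then have wG: "w \<in> G2 x" and dis: "N w \<inter> N y = {}" using W_iff by auto
    have "w \<in> H" using wG G2_sub[OF H(4)] by blast
    moreover have "w \<noteq> y" using wG yH by blast
    moreover have "w \<notin> G2 y" using dis E_sym unfolding G2_iff disjoint_iff N_iff by blast
    ultimately have "w \<in> H - insert y (G2 y)" by blast
    moreover have "x \<notin> G2 y" unfolding G2_iff using no_common E_sym by blast
    then have "x \<in> H - insert y (G2 y)" using H(4) xy_neq by blast
    ultimately have "w = x" using one[OF yH(1)] by (metis card_1_singletonE singletonD)
    then show False using wG by (simp add: G2_iff)
  qed
  then show ?thesis by (intro exI[of _ y] good_pair.intro far_pair_axioms good_pair_axioms.intro)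
qed

lemma good_pair_everywhere:
  assumes "good_pair V E m x0 y0" "x \<in> V"
  shows "\<exists>y. good_pair V E m x y"
proof -
  interpret good_pair V E m x0 y0 by fact
  define H where "H = {x0, y0} \<union> M x0 y0"
  have H: "H \<subseteq> V" "\<And>u v. E u v \<Longrightarrow> u \<in> H \<longleftrightarrow> v \<notin> H" "card H = 2 * (2 * m + 1) + 2"
    "card (V - H) = 2 * (2 * m + 1) + 2"
    using xV yV M_apart(1) bipartition card_parts unfolding H_def by blast+
  show ?thesis
  proof (cases "x \<in> H")
    case True
    then show ?thesis using good_partner H by blast
  next
    case False
    have "u \<in> V - H \<longleftrightarrow> v \<notin> V - H" if "E u v" for u v using that H(2) E_in_V by blast
    then show ?thesis using good_partner[of "V - H" x] H(4) False assms(2) by blast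
  qed
qed

lemma bipartite_partition:
  assumes good: "good_pair V E m x0 y0"
  shows "bipartite V E \<and> (\<forall>x\<in>V. \<exists>D3 D3'. D3 \<union> D3' = Gam V E 3 x \<and>
     map card [{x}, Gam V E 1 x, Gam V E 2 x, D3, D3', Gam V E 4 x]
       = [1, 2 * m + 1, 2 * (2 * m + 1), 2 * m + 1, 2, 1] \<and>
     equitable_partition V E [{x}, Gam V E 1 x, Gam V E 2 x, D3, D3', Gam V E 4 x]
       [[0, 2 * m + 1, 0, 0, 0, 0], [1, 0, 2 * m, 0, 0, 0], [0, m, 0, m, 1, 0],
        [0, 0, 2 * m, 0, 0, 1], [0, 0, 2 * m + 1, 0, 0, 0], [0, 0, 0, 2 * m + 1, 0, 0]])"
proof
  interpret good_pair V E m x0 y0 by fact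
  have "{x0, y0} \<union> M x0 y0 \<subseteq> V" using xV yV M_apart(1) by blast
  then show "bipartite V E" unfolding bipartite_def
    by (intro exI[of _ "{x0, y0} \<union> M x0 y0"] conjI allI impI bipartition)
next
  show "\<forall>x\<in>V. \<exists>D3 D3'. D3 \<union> D3' = Gam V E 3 x \<and>
     map card [{x}, Gam V E 1 x, Gam V E 2 x, D3, D3', Gam V E 4 x]
       = [1, 2 * m + 1, 2 * (2 * m + 1), 2 * m + 1, 2, 1] \<and>
     equitable_partition V E [{x}, Gam V E 1 x, Gam V E 2 x, D3, D3', Gam V E 4 x]
       [[0, 2 * m + 1, 0, 0, 0, 0], [1, 0, 2 * m, 0, 0, 0], [0, m, 0, m, 1, 0],
        [0, 0, 2 * m, 0, 0, 1], [0, 0, 2 * m + 1, 0, 0, 0], [0, 0, 0, 2 * m + 1, 0, 0]]"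
  proof
    fix x assume "x \<in> V"
    then obtain y where y: "good_pair V E m x y" using good_pair_everywhere[OF good] by blast
    show "\<exists>D3 D3'. D3 \<union> D3' = Gam V E 3 x \<and>
     map card [{x}, Gam V E 1 x, Gam V E 2 x, D3, D3', Gam V E 4 x]
       = [1, 2 * m + 1, 2 * (2 * m + 1), 2 * m + 1, 2, 1] \<and>
     equitable_partition V E [{x}, Gam V E 1 x, Gam V E 2 x, D3, D3', Gam V E 4 x]
       [[0, 2 * m + 1, 0, 0, 0, 0], [1, 0, 2 * m, 0, 0, 0], [0, m, 0, m, 1, 0],
        [0, 0, 2 * m, 0, 0, 1], [0, 0, 2 * m + 1, 0, 0, 0], [0, 0, 0, 2 * m + 1, 0, 0]]"
      by (rule good_pair.partition[OF y])
  qed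
qed

end

context tfree
begin

text \<open>These are the neighbours of \<open>x\<close> that behave as in the bipartite case; in
  valency 5 they have four neighbours in \<open>M x y\<close>, the others that reach
  \<open>M x y\<close> only three (\<open>card_T_W\<close>).\<close>

definition U :: "'a \<Rightarrow> 'a \<Rightarrow> 'a set" where
  "U x y = {a \<in> N x. N a \<inter> W x y = {}}"

lemma finite_W [simp]: "finite (W x y)"
  by (simp add: W_def)

lemma finite_U [simp]: "finite (U x y)"
  by (rule finite_subset[of _ "N x"]) (auto simp: U_def)

end

section \<open>Valency 5\<close>

locale far_pair2 = far_pair +
  assumes m2: "m = 2"
begin

lemma far_pair2_swap: "far_pair2 V E m y x"
  by (intro far_pair2.intro far_pair_swap far_pair2_axioms.intro m2)

text \<open>This and \<open>another_common\<close> are the two halves of mu = 2 in the form used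
  from here on.\<close>

lemma common_at_most_two:
  assumes "a \<noteq> b" "E a u" "E b u" "E a v" "E b v" "E a w" "E b w"
  shows "u = v \<or> u = w \<or> v = w"
proof (rule ccontr)
  assume "\<not> ?thesis"
  then have "card {u, v, w} = 3" by simp
  moreover have "card {u, v, w} \<le> card (N a \<inter> N b)" using assms by (intro card_mono) auto
  ultimately show False using card_mu[OF assms(1-3)] m2 by simp
qed

lemma another_common:
  assumes "a \<noteq> b" "E a u" "E b u"
  obtains v where "v \<noteq> u" "E a v" "E b v"
proof -
  have "card (N a \<inter> N b) = 2" using card_mu[OF assms] m2 by simp
  then have "\<not> N a \<inter> N b \<subseteq> {u}" using card_mono[of "{u}" "N a \<inter> N b"] by auto
  then obtain v where "v \<in> N a \<inter> N b" "v \<noteq> u" by blast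
  then show thesis using that[of v] by simp
qed

lemma first_neighbour_cases: "E x a \<Longrightarrow> E a u \<Longrightarrow> u = x \<or> u \<in> M x y \<or> u \<in> W x y"
  unfolding W_def Diff_iff G2_iff by blast

lemma W_apart:
  assumes "w \<in> W x y"
  shows "w \<noteq> x" "w \<notin> M x y" "E y b \<Longrightarrow> \<not> E b w" "E y b \<Longrightarrow> \<not> E w b" "w \<in> V" "\<not> E x w" "\<not> E y w" "\<exists>a. E x a \<and> E a w"
proof -
  have w: "w \<in> G2 x" "N w \<inter> N y = {}" using assms W_iff by blast+
  show "w \<noteq> x" "w \<notin> M x y" "\<exists>a. E x a \<and> E a w"
    using assms unfolding W_def Diff_iff G2_iff by blast+
  then obtain a where a: "E x a" "E a w" by blast
  then show "w \<in> V" "\<not> E x w" "\<not> E y w" using E_in_V(2) no_triangle no_path3 by blast+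
  show "\<not> E w b" if "E y b" using that w(2) by auto
  then show "\<not> E b w" if "E y b" using that E_sym by blast
qed

text \<open>Besides \<open>x\<close>, four neighbours of \<open>a\<close> remain;
  \<open>T_lower\<close> puts at least three of them into \<open>M x y\<close>.\<close>

lemma card_T_W:
  assumes "E x a" "N a \<inter> M x y \<noteq> {}"
  shows "card (N a \<inter> W x y) = (if a \<in> U x y then 0 else 1)"
    "card (N a \<inter> M x y) = (if a \<in> U x y then 4 else 3)"
proof -
  have "N a \<inter> W x y = {} \<longleftrightarrow> a \<in> U x y" using assms by (simp add: U_def)
  then have "card (N a \<inter> W x y) = 0 \<longleftrightarrow> a \<in> U x y" by simp
  moreover have "card (N a \<inter> M x y) \<ge> 3" "card (N a \<inter> M x y) + card (N a \<inter> W x y) = 4"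
    using T_lower[OF assms] card_first[OF assms(1)] m2 by simp_all
  ultimately have "(card (N a \<inter> M x y) = 4 \<and> card (N a \<inter> W x y) = 0 \<and> a \<in> U x y)
      \<or> (card (N a \<inter> M x y) = 3 \<and> card (N a \<inter> W x y) = 1 \<and> a \<notin> U x y)"
    by linarith
  then show "card (N a \<inter> W x y) = (if a \<in> U x y then 0 else 1)"
    "card (N a \<inter> M x y) = (if a \<in> U x y then 4 else 3)" by (elim disjE; simp)+
qed

lemma W_neighbour_unique:
  assumes "E x a" "N a \<inter> M x y \<noteq> {}" "w \<in> W x y" "E a w"
  shows "N a \<inter> W x y = {w}"
proof -
  have "card (N a \<inter> W x y) \<le> 1" using card_T_W(1)[OF assms(1,2)] by auto
  moreover have "{w} \<subseteq> N a \<inter> W x y" using assms by auto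
  ultimately show ?thesis using card_seteq[of "N a \<inter> W x y" "{w}"] by simp
qed

text \<open>\<open>w\<close> and \<open>z\<close> share \<open>a\<close> and a second vertex
  \<open>v\<close>. In \<open>N x\<close> it would have \<open>x\<close>, \<open>w\<close>,
  \<open>z\<close> in common with \<open>a\<close>; in \<open>N y\<close> it cannot be, by the
  choice of \<open>W\<close>. So \<open>v\<close> is the left-over neighbour of
  \<open>z\<close>.\<close>

lemma W_adj_ee:
  assumes a: "E x a" and w: "w \<in> W x y" "E a w" and z: "z \<in> M x y" "E a z"
  shows "E w (ee x y z)"
proof -
  have "w \<noteq> z" using W_apart(2)[OF w(1)] z by blast
  moreover have wa: "E w a" "E z a" using w z E_sym by blast+
  ultimately obtain v where v: "v \<noteq> a" "E w v" "E z v" by (rule another_common)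
  have "\<not> E x v"
  proof
    assume "E x v"
    then have "x = w \<or> x = z \<or> w = z"
      using common_at_most_two[of a v x w z] v a w z E_sym by blast
    then show False using W_apart(1)[OF w(1)] M_apart(2)[OF z(1)] \<open>w \<noteq> z\<close> by blast
  qed
  moreover have "\<not> E y v" using W_apart(4)[OF w(1)] v by blast
  ultimately show ?thesis using ee_unique[OF z(1) v(3)] v by simp
qed

text \<open>The two common neighbours of \<open>a\<close> and e(z) lie in \<open>M x y\<close> or
  \<open>W x y\<close>. If \<open>a\<close> is outside \<open>U x y\<close>, its only neighbour in
  \<open>W x y\<close> is one of them by \<open>W_adj_ee\<close>.\<close>

lemma card_ee_first:
  assumes z: "z \<in> M x y" and a: "E x a" "E z a"
  shows "card (N a \<inter> (N (ee x y z) \<inter> M x y)) = (if a \<in> U x y then 2 else 1)"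
proof -
  define e where "e = ee x y z"
  have az: "E a z" using a E_sym by blast
  have ne: "N a \<inter> M x y \<noteq> {}" using az z by auto
  note e = eeD[OF z, folded e_def]
  have "a \<noteq> e" using a e by blast
  then have c2: "card (N a \<inter> N e) = 2" using card_mu[of a e z] az e m2 by simp
  have ex: "\<not> E e x" using e E_sym by blast
  have split: "N a \<inter> N e = (N a \<inter> (N e \<inter> M x y)) \<union> (N a \<inter> W x y \<inter> N e)"
    using first_neighbour_cases[OF a(1)] ex unfolding set_eq_iff Un_iff Int_iff N_iff by blast
  have "(N a \<inter> (N e \<inter> M x y)) \<inter> (N a \<inter> W x y \<inter> N e) = {}" using W_apart(2) by blast
  then have sum: "card (N a \<inter> (N e \<inter> M x y)) + card (N a \<inter> W x y \<inter> N e) = 2"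
    using c2 split by (metis card_Un_disjoint finite_Int finite_N)
  show ?thesis
  proof (cases "a \<in> U x y")
    case True
    then have "N a \<inter> W x y = {}" by (simp add: U_def)
    then show ?thesis using sum True by (simp add: e_def)
  next
    case False
    then obtain w where w: "w \<in> W x y" "E a w" using a by (auto simp: U_def)
    have "E e w" using W_adj_ee[OF a(1) w z az] E_sym by (simp add: e_def)
    then have "N a \<inter> W x y \<inter> N e = {w}" using W_neighbour_unique[OF a(1) ne w] by simp
    then show ?thesis using sum False by (simp add: e_def)
  qed
qed

lemma sum_card_ee_first:
  assumes z: "z \<in> M x y"
  shows "(\<Sum>a\<in>N z \<inter> N x. card (N a \<inter> (N (ee x y z) \<inter> M x y)) - 1) = card (N z \<inter> U x y)"
proof -
  have "(\<Sum>a\<in>N z \<inter> N x. card (N a \<inter> (N (ee x y z) \<inter> M x y)) - 1)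
      = (\<Sum>a\<in>N z \<inter> N x. if a \<in> U x y then 1 else 0)"
    using card_ee_first[OF z] by (intro sum.cong) auto
  also have "\<dots> = card (N z \<inter> N x \<inter> U x y)"
    using sum.inter_restrict[of "N z \<inter> N x" "\<lambda>_. 1::nat" "U x y"] by (simp del: N_iff)
  also have "N z \<inter> N x \<inter> U x y = N z \<inter> U x y" by (auto simp: U_def)
  finally show ?thesis .
qed

text \<open>In \<open>common_ee_count\<close> the factor m - 1 is 1 and, by
  \<open>card_ee_first\<close>, each summand is the indicator of \<open>U\<close>.\<close>

lemma card_ee:
  assumes z: "z \<in> M x y"
  shows "card (N (ee x y z) \<inter> M x y) = 1 + (card (N z \<inter> U x y) + card (N z \<inter> U y x))"
proof -
  interpret s: far_pair2 V E m y x by (rule far_pair2_swap)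
  have z': "z \<in> M y x" using z M_sym by blast
  have "card (N (ee x y z) \<inter> M x y) - 1 = card (N z \<inter> U x y) + card (N z \<inter> U y x)"
    using common_ee_count[OF z refl] sum_card_ee_first[OF z] s.sum_card_ee_first[OF z'] m2
    unfolding M_sym[of y x] ee_sym[of y x] by simp
  moreover have "z \<in> N (ee x y z) \<inter> M x y" using z eeD[OF z] by simp
  then have "card (N (ee x y z) \<inter> M x y) > 0" by (subst card_gt_0_iff) (intro conjI finite_Int disjI1 finite_N; blast)
  ultimately show ?thesis by linarith
qed

lemma sum_U:
  "(\<Sum>z\<in>M x y. card (N z \<inter> U x y)) = 4 * card (U x y)"
proof -
  have "card (N u \<inter> M x y) = 4" if "u \<in> U x y" for u
    using that card_first[of u] m2 by (simp add: U_def)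
  then show ?thesis using card_edges_commute[of "M x y" "U x y"] by simp
qed

text \<open>Each such neighbour \<open>a\<close> of \<open>z\<close> carries a vertex of
  \<open>W x y\<close>, which is adjacent to e(z). Different \<open>a\<close>, \<open>a'\<close>
  carry different ones because they already share \<open>x\<close> and \<open>z\<close>.\<close>

lemma card_W_le:
  assumes z: "z \<in> M x y"
  shows "card (N z \<inter> N x - U x y) \<le> card (N (ee x y z) \<inter> W x y)"
proof -
  define f where "f a = (SOME w. w \<in> N a \<inter> W x y)" for a
  have f: "f a \<in> N a \<inter> W x y" if "a \<in> N z \<inter> N x - U x y" for a
  proof -
    have "N a \<inter> W x y \<noteq> {}" using that by (simp add: U_def)
    then show ?thesis unfolding f_def by (simp only: some_in_eq not_False_eq_True)
  qed
  show ?thesis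
  proof (rule card_inj_on_le)
    show "f ` (N z \<inter> N x - U x y) \<subseteq> N (ee x y z) \<inter> W x y"
    proof
      fix w assume "w \<in> f ` (N z \<inter> N x - U x y)"
      then obtain a where a: "a \<in> N z \<inter> N x - U x y" "w = f a" by blast
      have w: "w \<in> W x y" "E a w" using f[OF a(1)] a(2) by simp_all
      have "E x a" "E a z" using a(1) E_sym[of z a] by simp_all
      then show "w \<in> N (ee x y z) \<inter> W x y"
        using W_adj_ee[OF _ w z] w E_sym by simp
    qed
    show "inj_on f (N z \<inter> N x - U x y)"
    proof (rule inj_onI, rule ccontr)
      fix a a' assume a: "a \<in> N z \<inter> N x - U x y" "a' \<in> N z \<inter> N x - U x y" "f a = f a'" "a \<noteq> a'"
      have w: "f a \<in> W x y" "E a (f a)" "E a' (f a)" using f[OF a(1)] f[OF a(2)] a(3) by simp_all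
      have e: "E x a" "E z a" "E x a'" "E z a'" using a by auto
      then have "x = z \<or> x = f a \<or> z = f a"
        using common_at_most_two[OF a(4), of x z "f a"] w E_sym by blast
      then show False using W_apart[OF w(1)] M_apart[OF z] z by blast
    qed
  qed simp
qed

lemma W_disjoint: "W x y \<inter> W y x = {}"
proof -
  interpret s: far_pair2 V E m y x by (rule far_pair2_swap)
  show ?thesis using W_apart(8,3) s.W_apart(8) by blast
qed

text \<open>If \<open>z\<close> has u neighbours in \<open>U x y\<close> and u' in
  \<open>U y x\<close>, then e(z) has 1 + u + u' neighbours in \<open>M x y\<close>, at least 2 - u
  in \<open>W x y\<close> and at least 2 - u' in \<open>W y x\<close>. The three sets are disjoint
  and the bounds add up to the valency 5, so all are equalities.\<close>

lemma N_ee_subset: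
  assumes z: "z \<in> M x y"
  shows "N (ee x y z) \<subseteq> M x y \<union> W x y \<union> W y x"
    and "card (N (ee x y z) \<inter> W x y) = card (N z \<inter> N x - U x y)"
proof -
  interpret s: far_pair2 V E m y x by (rule far_pair2_swap)
  define e where "e = ee x y z"
  have z': "z \<in> M y x" using z M_sym by blast
  have U: "card (N z \<inter> N x - U x y) = 2 - card (N z \<inter> U x y)"
    "card (N z \<inter> U x y) \<le> 2"
    if "card (N z \<inter> N x) = 2" for x y
  proof -
    have "N z \<inter> N x - U x y = N z \<inter> N x - (N z \<inter> U x y)" by blast
    moreover have "N z \<inter> U x y \<subseteq> N z \<inter> N x" by (auto simp: U_def)
    ultimately show "card (N z \<inter> N x - U x y) = 2 - card (N z \<inter> U x y)"
       "card (N z \<inter> U x y) \<le> 2"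
      using that card_mono[of "N z \<inter> N x" "N z \<inter> U x y"] by (simp_all add: card_Diff_subset)
  qed
  note Ux = U[of x y] and Uy = U[of y x]
  have le: "2 - card (N z \<inter> U x y) \<le> card (N e \<inter> W x y)" "2 - card (N z \<inter> U y x) \<le> card (N e \<inter> W y x)"
    using card_W_le[OF z] s.card_W_le[OF z'] Ux Uy card_A[OF z] card_B[OF z] m2
    unfolding ee_sym[of y x] e_def by simp_all
  have "card (N e) = 5" using card_N[of e] E_in_V(2)[OF eeD(1)[OF z]] m2 by (simp add: e_def)
  define S where "S = (N e \<inter> M x y) \<union> (N e \<inter> W x y) \<union> (N e \<inter> W y x)"
  have "card S = card (N e \<inter> M x y) + card (N e \<inter> W x y) + card (N e \<inter> W y x)"
  proof -
    have d: "(N e \<inter> M x y) \<inter> (N e \<inter> W x y) = {}" "((N e \<inter> M x y) \<union> (N e \<inter> W x y)) \<inter> (N e \<inter> W y x) = {}"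
      using W_apart(2) s.W_apart(2) W_disjoint unfolding M_sym[of y x] by blast+
    show ?thesis unfolding S_def using card_Un_disjoint[OF _ _ d(2)] card_Un_disjoint[OF _ _ d(1)] by simp
  qed
  moreover have "card (N e \<inter> M x y) = 1 + (card (N z \<inter> U x y) + card (N z \<inter> U y x))"
    unfolding e_def by (rule card_ee[OF z])
  moreover have "card S \<le> card (N e)" by (intro card_mono) (auto simp: S_def)
  moreover have "card (N z \<inter> U x y) \<le> 2" "card (N z \<inter> U y x) \<le> 2"
    using Ux Uy card_A[OF z] card_B[OF z] m2 by simp_all
  ultimately have S: "card S = card (N e)" "card (N e \<inter> W x y) = 2 - card (N z \<inter> U x y)"
    using le \<open>card (N e) = 5\<close> by linarith+
  then have "S = N e" by (intro card_subset_eq) (auto simp: S_def)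
  then show "N (ee x y z) \<subseteq> M x y \<union> W x y \<union> W y x" by (auto simp: S_def e_def)
  show "card (N (ee x y z) \<inter> W x y) = card (N z \<inter> N x - U x y)"
    using S(2) Ux card_A[OF z] m2 by (simp add: e_def)
qed

lemma ee_no_first:
  assumes z: "z \<in> M x y" and a: "E x a"
  shows "\<not> E a (ee x y z)"
proof
  interpret s: far_pair2 V E m y x by (rule far_pair2_swap)
  assume "E a (ee x y z)"
  then have "a \<in> N (ee x y z)" using E_sym by simp
  then have "a \<in> M x y \<or> a \<in> W x y \<or> a \<in> W y x" using N_ee_subset[OF z] by blast
  then show False using M_apart(4) W_apart(6) s.W_apart(7) a by blast
qed

lemma ee_inj:
  assumes a: "E x a" "a \<notin> U x y"
  shows "inj_on (ee x y) (N a \<inter> M x y)"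
proof (rule inj_onI)
  fix z z' assume z: "z \<in> N a \<inter> M x y" "z' \<in> N a \<inter> M x y" "ee x y z = ee x y z'"
  have zM: "z \<in> M x y" "z' \<in> M x y" "E z a" using z E_sym by auto
  have "z \<in> N a \<inter> (N (ee x y z) \<inter> M x y)" "z' \<in> N a \<inter> (N (ee x y z) \<inter> M x y)"
    using z eeD(2)[OF zM(1)] eeD(2)[OF zM(2)] by auto
  moreover have "card (N a \<inter> (N (ee x y z) \<inter> M x y)) = 1"
    using card_ee_first[OF zM(1) a(1) zM(3)] a(2) by simp
  ultimately show "z = z'" by (metis card_1_singletonE singletonD)
qed

text \<open>Two of the five neighbours of \<open>w\<close> lie in \<open>N x\<close>. Since
  \<open>a\<close> is outside \<open>U x y\<close> it has three neighbours in \<open>M x y\<close>,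
  their left-over neighbours are distinct and adjacent to \<open>w\<close>, so these are the other
  three. The left side does not depend on \<open>a\<close>, which \<open>ee_along_W\<close>
  exploits.\<close>

lemma N_W:
  assumes w: "w \<in> W x y" and a: "E x a" "E a w" "N a \<inter> M x y \<noteq> {}"
  shows "N w - N x = ee x y ` (N a \<inter> M x y)"
proof (rule card_subset_eq[symmetric])
  have aU: "a \<notin> U x y" using a w by (auto simp: U_def)
  show "ee x y ` (N a \<inter> M x y) \<subseteq> N w - N x"
    using W_adj_ee[OF a(1) w a(2)] eeD(3) by auto
  have "card (N w - N x) = card (N w) - card (N w \<inter> N x)"
    by (simp add: card_Diff_subset_Int)
  also have "\<dots> = 3" using card_N[OF W_apart(5)[OF w]] card_W_first[OF w] m2 by simp
  also have "3 = card (ee x y ` (N a \<inter> M x y))"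
    using card_image[OF ee_inj[OF a(1) aU]] card_T_W(2)[OF a(1,3)] aU by simp
  finally show "card (ee x y ` (N a \<inter> M x y)) = card (N w - N x)" ..
qed simp

end

section \<open>The possible sizes of \<open>W x y\<close>\<close>

context far_pair2
begin

lemma M_ne: "M x y \<noteq> {}"
  by (rule far_meet[OF far])

text \<open>A neighbour \<open>p\<close> of \<open>x\<close> that reaches \<open>M x y\<close>
  shares with \<open>r\<close> a vertex besides \<open>x\<close>, and this is the single neighbour
  of \<open>p\<close> in \<open>W x y\<close>. A second such \<open>r'\<close> would share the same
  vertex, giving it and \<open>x\<close> three common neighbours \<open>p\<close>, \<open>r\<close>,
  \<open>r'\<close>. Hence \<open>W x y\<close> is exactly what hangs on \<open>r\<close>.\<close>

lemma isolated:
  assumes r: "E x r" "N r \<inter> M x y = {}"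
  shows "W x y = N r - {x}" "card (W x y) = 4" "U x y = {}"
    and "\<And>p. E x p \<Longrightarrow> N p \<inter> M x y = {} \<Longrightarrow> p = r"
proof -
  have sub: "N r' - {x} \<subseteq> W x y" if "E x r'" "N r' \<inter> M x y = {}" for r'
    using first_neighbour_cases[OF that(1)] that(2) unfolding subset_iff disjoint_iff Diff_iff N_iff by blast
  have shared: "\<exists>u. N p \<inter> W x y = {u} \<and> E p u \<and> E r' u \<and> u \<noteq> x"
    if p: "E x p" "N p \<inter> M x y \<noteq> {}" and r': "E x r'" "N r' \<inter> M x y = {}" for p r'
  proof -
    have "p \<noteq> r'" using p r' by auto
    then obtain u where u: "u \<noteq> x" "E p u" "E r' u" by (rule another_common[of p r' x]) (use p r' E_sym in blast)+
    then have "u \<in> W x y" using sub[OF r'] by auto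
    then show ?thesis using W_neighbour_unique[OF p _ u(2)] u by blast
  qed
  obtain z where z: "z \<in> M x y" using M_ne by blast
  then obtain p where p: "E x p" "E p z" using M_ends by blast
  have pM: "N p \<inter> M x y \<noteq> {}" using p z by auto
  show unique: "r' = r" if r': "E x r'" "N r' \<inter> M x y = {}" for r'
  proof (rule ccontr)
    assume "r' \<noteq> r"
    obtain u u' where u: "N p \<inter> W x y = {u}" "E p u" "E r u" "u \<noteq> x" "N p \<inter> W x y = {u'}" "E r' u'"
      using shared[OF p(1) pM r] shared[OF p(1) pM r'] by blast
    then have "u' = u" by blast
    then have "p = r \<or> p = r' \<or> r = r'"
      using common_at_most_two[of u x p r r'] u p r r' E_sym by blast
    then show False using pM r r' \<open>r' \<noteq> r\<close> by blast
  qed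
  show W: "W x y = N r - {x}"
  proof
    show "W x y \<subseteq> N r - {x}"
    proof
      fix w assume w: "w \<in> W x y"
      then obtain a where a: "E x a" "E a w" using W_apart(8) by blast
      have "E r w"
      proof (cases "N a \<inter> M x y = {}")
        case True
        then show ?thesis using unique[OF a(1)] a by blast
      next
        case False
        then obtain u where "N a \<inter> W x y = {u}" "E r u" using shared[OF a(1) False r] by blast
        moreover have "w \<in> N a \<inter> W x y" using a w by simp
        ultimately show ?thesis by simp
      qed
      then show "w \<in> N r - {x}" using W_apart(1)[OF w] by simp
    qed
  qed (rule sub[OF r])
  have "card (N r) = 5" "x \<in> N r" using card_N[OF E_in_V(2)[OF r(1)]] m2 E_sym[OF r(1)] by simp_all
  then show "card (W x y) = 4" using W by simp
  then have ne: "N r \<inter> W x y \<noteq> {}" using W by (metis Diff_subset card.empty inf.absorb2 zero_neq_numeral)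
  show "U x y = {}"
  proof (rule ccontr)
    assume "U x y \<noteq> {}"
    then obtain a where a: "E x a" "N a \<inter> W x y = {}" by (auto simp: U_def)
    then show False using ne unique[OF a(1)] shared[OF a(1) _ r] by blast
  qed
qed

text \<open>Count the edges between \<open>N x\<close> and \<open>W x y\<close>: two at each vertex
  of \<open>W x y\<close>, one at each of the five neighbours of \<open>x\<close> outside
  \<open>U x y\<close>.\<close>

lemma card_W_U:
  assumes "\<And>a. E x a \<Longrightarrow> N a \<inter> M x y \<noteq> {}"
  shows "2 * card (W x y) + card (U x y) = 5"
proof -
  have "(\<Sum>a\<in>N x. card (N a \<inter> W x y)) = (\<Sum>w\<in>W x y. card (N w \<inter> N x))"
    by (rule card_edges_commute) auto
  also have "\<dots> = 2 * card (W x y)" using card_W_first m2 by simp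
  also have "(\<Sum>a\<in>N x. card (N a \<inter> W x y)) = (\<Sum>a\<in>N x. if a \<in> N x - U x y then 1 else 0)"
    using card_T_W(1)[OF _ assms] by (intro sum.cong) auto
  also have "\<dots> = card (N x \<inter> (N x - U x y))"
    using sum.inter_restrict[of "N x" "\<lambda>_. 1::nat" "N x - U x y"] by (simp del: N_iff)
  also have "N x \<inter> (N x - U x y) = N x - U x y" by blast
  also have "card (N x - U x y) = 5 - card (U x y)"
    using card_N[OF xV] m2 by (subst card_Diff_subset[OF finite_U]) (auto simp: U_def)
  finally show ?thesis using card_mono[of "N x" "U x y"] card_N[OF xV] m2 by (simp add: U_def subset_iff)
qed

text \<open>If some neighbour of \<open>x\<close> were at distance 4 from \<open>y\<close>, the graph would look like the 5-cube and have diameter 5.\<close>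

lemma not_isolated:
  assumes r: "E x r"
  shows "N r \<inter> M x y \<noteq> {}"
proof
  interpret s: far_pair2 V E m y x by (rule far_pair2_swap)
  assume "N r \<inter> M x y = {}"
  note W = isolated[OF r this]
  \<comment> \<open>|W| = 4 contradicts 2|W| + |U| = 5, so \<open>y\<close> also has a neighbour
    \<open>q\<close> without neighbours in \<open>M\<close>. It is then far from \<open>x\<close>,
    and \<open>far_meet\<close> applies to the new pair.\<close>
  have "\<not> (\<forall>b. E y b \<longrightarrow> N b \<inter> M y x \<noteq> {})"
    using s.card_W_U W(2) card_W_sym by auto
  then obtain q where q: "E y q" "N q \<inter> M y x = {}" by blast
  note W' = s.isolated[OF q]
  have no_path: "\<not> E a u" if a: "E x a" and u: "E q u" for a u
  proof
    assume au: "E a u"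
    have "u \<in> M x y" using M_I[OF a au] E_sym[OF u] E_sym[OF q(1)] by blast
    then show False using q(2) u M_sym by auto
  qed
  have "far x q"
    unfolding far_iff
  proof (intro conjI allI impI)
    show "x \<in> V" "q \<in> V" using xV q E_in_V by auto
    show "x \<noteq> q" "\<not> E x q" using q not_adjacent no_common by blast+
    show "\<not> E q a" if "E x a" for a using no_path3[OF that q(1)] E_sym by blast
  qed (rule no_path)
  then obtain v where v: "v \<in> M x q" using far_meet by blast
  then obtain a u where au: "E x a" "E a v" "E q u" "E u v" unfolding M_iff by blast
  have "u \<noteq> y" using no_path3[OF au(1), of v] au by blast
  then have uW: "u \<in> W y x" using W'(1) au(3) by simp
  obtain b where b: "E y b" "E b u" "b \<noteq> q"
  proof (rule another_common[of y u q])
    show "y \<noteq> u" using \<open>u \<noteq> y\<close> by blast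
  qed (use q au E_sym that in blast)+
  have bM: "N b \<inter> M y x \<noteq> {}" using W'(4)[OF b(1)] b(3) by blast
  have "\<not> E y v" using no_path3[OF au(1), of v] au by blast
  \<comment> \<open>By \<open>N_W\<close>, seen from \<open>y\<close>, \<open>v\<close> is the
    left-over neighbour of some \<open>z\<close> in \<open>M x y\<close>, and such vertices have no
    neighbour in \<open>N x\<close>.\<close>
  then have "v \<in> N u - N y" using au by simp
  then obtain z where z: "z \<in> M y x" "v = ee y x z" using s.N_W[OF uW b(1,2) bM] by auto
  then have "z \<in> M x y" "v = ee x y z" using M_sym ee_sym by auto
  then show False using ee_no_first[OF _ au(1)] au(2) by blast
qed

lemma card_W_U_eq: "2 * card (W x y) + card (U x y) = 5"
  by (rule card_W_U[OF not_isolated])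

text \<open>If |W| = 1, every \<open>z\<close> has a neighbour in \<open>U\<close> on both sides,
  since two neighbours outside \<open>U\<close> would yield two vertices of \<open>W\<close>. So the
  classes of equal e(z) have at least 3 elements. They partition the 9 vertices of
  \<open>M x y\<close>, and a neighbour of \<open>x\<close> outside \<open>U\<close> meets three of
  them; so there are exactly three, of size 3, and each \<open>z\<close> has exactly 2 neighbours in
  the two \<open>U\<close> sets. That gives 18 incidences, while |U| = 3 on each side gives 12 +
  12.\<close>

lemma card_W_neq_1: "card (W x y) \<noteq> 1"
proof
  interpret s: far_pair2 V E m y x by (rule far_pair2_swap)
  assume 1: "card (W x y) = 1"
  have aux: "1 \<le> card (N z \<inter> U x y)" if z: "z \<in> M x y" and "card (W x y) = 1" and p: "far_pair2 V E m x y" for x y z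
  proof -
    interpret far_pair2 V E m x y by (rule p)
    have "N z \<inter> U x y \<noteq> {}"
    proof
      assume "N z \<inter> U x y = {}"
      then have "N z \<inter> N x - U x y = N z \<inter> N x" by blast
      then have "2 \<le> card (N (ee x y z) \<inter> W x y)" using card_W_le[OF z] card_A[OF z] m2 by simp
      also have "\<dots> \<le> card (W x y)" by (intro card_mono) auto
      finally show False using that(2) by simp
    qed
    moreover have "finite (N z \<inter> U x y)" by simp
    ultimately show ?thesis by (simp add: Suc_leI card_gt_0_iff)
  qed
  define F where "F = ee x y ` M x y"
  have finF: "finite F" by (simp add: F_def)
  have M9: "card (M x y) = 9" using card_M_W 1 m2 by simp
  have s3: "3 \<le> card (N (ee x y z) \<inter> M x y)" if z: "z \<in> M x y" for z
    using aux[OF z 1 far_pair2_axioms] aux[of z y x] z 1 M_sym[of x y] card_W_sym far_pair2_swap card_ee[OF z] by simp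
  obtain w where w: "w \<in> W x y" using 1 by (metis card.empty ex_in_conv zero_neq_one)
  obtain a where a: "E x a" "E a w" using W_apart(8)[OF w] by blast
  have aU: "a \<notin> U x y" using a w by (auto simp: U_def)
  have "card (ee x y ` (N a \<inter> M x y)) = 3"
    using card_image[OF ee_inj[OF a(1) aU]] card_T_W(2)[OF a(1) not_isolated[OF a(1)]] aU by simp
  moreover have "ee x y ` (N a \<inter> M x y) \<subseteq> F" by (auto simp: F_def)
  ultimately have F3: "3 \<le> card F" using card_mono[OF finF] by metis
  \<comment> \<open>The truncated subtraction is exact because each class has at least 3
    elements.\<close>
  have "(\<Sum>e\<in>F. 3 + (card (N e \<inter> M x y) - 3)) = (\<Sum>e\<in>F. card (N e \<inter> M x y))"
    using s3 by (intro sum.cong) (auto simp: F_def)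
  also have "\<dots> = 9" using sum_D M9 by (simp add: F_def)
  finally have "3 * card F + (\<Sum>e\<in>F. card (N e \<inter> M x y) - 3) = 9" by (simp add: sum.distrib)
  then have "(\<Sum>e\<in>F. card (N e \<inter> M x y) - 3) = 0" using F3 by linarith
  then have "\<forall>e\<in>F. card (N e \<inter> M x y) - 3 = 0" using finF by (simp only: sum_eq_0_iff)
  then have "card (N z \<inter> U x y) + card (N z \<inter> U y x) = 2" if "z \<in> M x y" for z
    using s3[OF that] card_ee[OF that] that by (force simp: F_def)
  then have "(\<Sum>z\<in>M x y. card (N z \<inter> U x y) + card (N z \<inter> U y x)) = 18" using M9 by simp
  moreover have "card (U x y) = 3" "card (U y x) = 3" using card_W_U_eq s.card_W_U_eq card_W_sym 1 by simp_all
  ultimately show False using sum_U s.sum_U M_sym[of x y] by (simp add: sum.distrib)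
qed

end

section \<open>The case |W| = 2\<close>

locale exceptional = far_pair2 +
  assumes W_ne: "W x y \<noteq> {}"
begin

lemma card_W: "card (W x y) = 2" and card_U: "card (U x y) = 1" and card_M: "card (M x y) = 8"
proof -
  have "card (W x y) \<noteq> 0" using W_ne by simp
  then show 1: "card (W x y) = 2" using card_W_U_eq card_W_neq_1 by linarith
  show "card (U x y) = 1" using card_W_U_eq 1 by linarith
  show "card (M x y) = 8" using card_M_W 1 m2 by simp
qed

lemma exceptional_swap: "exceptional V E m y x"
proof -
  have "card (W y x) = 2" using card_W card_W_sym by simp
  then have "W y x \<noteq> {}" by auto
  then show ?thesis by (intro exceptional.intro far_pair2_swap exceptional_axioms.intro)
qed

lemma U_le: "card (N z \<inter> U x y) \<le> 1"
  using card_mono[of "U x y" "N z \<inter> U x y"] card_U by simp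

text \<open>The average over the 8 vertices of \<open>M x y\<close> is 1, as |U| = 1 on each side
  gives 4 + 4 incidences, so an upper bound suffices. If \<open>z\<close> had count 2, its class D
  would have 3 members, all of count 2 by \<open>card_ee\<close> and so all adjacent to the single
  vertex \<open>p\<close> of \<open>U x y\<close>; but \<open>p\<close> has only 2 neighbours in
  D.\<close>

lemma count_U:
  assumes z: "z \<in> M x y"
  shows "card (N z \<inter> U x y) + card (N z \<inter> U y x) = 1"
proof -
  interpret s: exceptional V E m y x by (rule exceptional_swap)
  let ?h = "\<lambda>z. card (N z \<inter> U x y) + card (N z \<inter> U y x)"
  have le: "?h z \<le> 1" if z: "z \<in> M x y" for z
  proof (rule ccontr)
    assume "\<not> ?h z \<le> 1"
    then have h: "?h z = 2" "card (N z \<inter> U x y) = 1" using U_le s.U_le[of z] U_le[of z] by linarith+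
    obtain p where p: "U x y = {p}" using card_U by (rule card_1_singletonE)
    define D where "D = N (ee x y z) \<inter> M x y"
    have "D \<subseteq> N p \<inter> D"
    proof
      fix z' assume z': "z' \<in> D"
      then have zM: "z' \<in> M x y" "E z' (ee x y z)" using E_sym by (auto simp: D_def)
      have "ee x y z' = ee x y z" using ee_unique[OF zM] eeD[OF z] by blast
      then have "?h z' = 2" using card_ee[OF z] card_ee[OF zM(1)] h by simp
      then have "card (N z' \<inter> U x y) = 1" using U_le[of z'] s.U_le[of z'] by linarith
      then have "p \<in> N z'" using p by (cases "p \<in> N z'") auto
      then show "z' \<in> N p \<inter> D" using z' E_sym by simp
    qed
    then have "card D \<le> card (N p \<inter> D)" by (intro card_mono) auto
    moreover have px: "E x p" using p by (auto simp: U_def)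
    moreover have "p \<in> N z" using p h(2) by (cases "p \<in> N z") auto
    then have "card (N p \<inter> D) \<le> 2"
      using card_ee_first[OF z, of p] p px unfolding D_def by simp
    moreover have "card D = 3" using card_ee[OF z] h unfolding D_def by simp
    ultimately show False by simp
  qed
  have "(\<Sum>z\<in>M x y. ?h z) = (\<Sum>z\<in>M x y. 1)"
    using sum_U s.sum_U M_sym[of x y] card_U s.card_U card_M by (simp add: sum.distrib)
  then have "(\<Sum>z\<in>M x y. 1 - ?h z) = 0" using sum_subtractf_nat[of "M x y" ?h "\<lambda>_. 1"] le by simp
  then have "1 - ?h z = 0" using z by (simp only: sum_eq_0_iff finite_M)
  then show ?thesis using le[OF z] by linarith
qed

end

section \<open>The exceptional graph\<close>

text \<open>Positions in a list of the 14 vertices: points at 0 to 6, blocks at 7 to 13.\<close>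

fun slot :: "nat + nat \<Rightarrow> nat" where
  "slot (Inl i) = i"
| "slot (Inr j) = 7 + j"

lemma slot_less: "s \<in> Delta41_V \<Longrightarrow> slot s < 14"
  by (auto simp: Delta41_V_def)

lemma slot_inj: "inj_on slot Delta41_V"
  by (auto simp: Delta41_V_def inj_on_def)

lemma card_inc41:
  assumes "i < 7"
  shows "card {j. inc41 i j} = 4" "card {j. inc41 j i} = 4"
proof -
  have "\<forall>i\<in>set [0..<7]. length (filter (inc41 i) [0..<7]) = 4 \<and> length (filter (\<lambda>j. inc41 j i) [0..<7]) = 4"
    by code_simp
  then have "length (filter (inc41 i) [0..<7]) = 4" "length (filter (\<lambda>j. inc41 j i) [0..<7]) = 4"
    using assms by simp_all
  then have "card (set (filter (inc41 i) [0..<7])) = 4" "card (set (filter (\<lambda>j. inc41 j i) [0..<7])) = 4"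
    by (subst distinct_card; simp)+
  moreover have "set (filter (inc41 i) [0..<7]) = {j. inc41 i j}"
    "set (filter (\<lambda>j. inc41 j i) [0..<7]) = {j. inc41 j i}"
    by (auto simp: inc41_def)
  ultimately show "card {j. inc41 i j} = 4" "card {j. inc41 j i} = 4" by simp_all
qed

lemma Delta41_E_simps:
  "Delta41_E (Inl p) (Inr i) \<longleftrightarrow> inc41 p i" "Delta41_E (Inr i) (Inl p) \<longleftrightarrow> inc41 p i"
  "\<not> Delta41_E (Inl p) (Inl q)" "\<not> Delta41_E (Inr i) (Inr j)"
  by (simp_all add: Delta41_E_def)

lemma Delta41_E_in_V: "Delta41_E s t \<Longrightarrow> s \<in> Delta41_V \<and> t \<in> Delta41_V"
  by (cases s; cases t) (auto simp: Delta41_E_simps Delta41_V_def inc41_def)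

lemma card_Delta41_nbrs:
  assumes "s \<in> Delta41_V"
  shows "card {t. Delta41_E s t} = 4"
proof (cases s)
  case (Inl p)
  have "{t. Delta41_E s t} = Inr ` {i. inc41 p i}"
  proof (rule set_eqI)
    fix t show "t \<in> {t. Delta41_E s t} \<longleftrightarrow> t \<in> Inr ` {i. inc41 p i}"
      unfolding Inl by (cases t) (auto simp: Delta41_E_simps)
  qed
  then show ?thesis using card_inc41(1)[of p] assms by (auto simp: Inl card_image Delta41_V_def)
next
  case (Inr i)
  have "{t. Delta41_E s t} = Inl ` {p. inc41 p i}"
  proof (rule set_eqI)
    fix t show "t \<in> {t. Delta41_E s t} \<longleftrightarrow> t \<in> Inl ` {p. inc41 p i}"
      unfolding Inr by (cases t) (auto simp: Delta41_E_simps)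
  qed
  then show ?thesis using card_inc41(2)[of i] assms by (auto simp: Inr card_image Delta41_V_def)
qed

text \<open>An injective edge-preserving map between graphs of the same valency is an isomorphism onto a connected graph.\<close>

lemma (in tfree) iso_of_lists:
  assumes m2: "m = 2"
    and len: "length l1 = 14" "length l2 = 14" and dist: "distinct (l1 @ l2)"
    and e1: "\<And>i j. inc41 i j \<Longrightarrow> E (l1 ! i) (l1 ! (7 + j))"
    and e2: "\<And>i j. inc41 i j \<Longrightarrow> E (l2 ! i) (l2 ! (7 + j))"
    and e12: "\<And>i. i < 14 \<Longrightarrow> E (l1 ! i) (l2 ! i)"
  shows "graph_iso V E (cart_V K2_V Delta41_V) (cart_E K2_E Delta41_E)"
proof -
  define V' where "V' = cart_V K2_V Delta41_V"
  define E' where "E' = cart_E K2_E Delta41_E"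
  define g where "g u = (if fst u then l2 else l1) ! slot (snd u)" for u :: "bool \<times> (nat + nat)"
  have V': "u \<in> V' \<longleftrightarrow> snd u \<in> Delta41_V" for u by (cases u) (simp add: V'_def cart_V_def K2_V_def)
  have E': "E' u w \<longleftrightarrow> (fst w = (\<not> fst u) \<and> snd u = snd w) \<or> (fst u = fst w \<and> Delta41_E (snd u) (snd w))" for u w
    by (auto simp: E'_def cart_E_def K2_E_def)
  have inj: "inj_on g V'"
  proof (rule inj_onI)
    fix u w assume u: "u \<in> V'" and w: "w \<in> V'" and eq: "g u = g w"
    have g: "g u = (l1 @ l2) ! (slot (snd u) + (if fst u then 14 else 0))"
      "slot (snd u) + (if fst u then 14 else 0) < length (l1 @ l2)" if "u \<in> V'" for u
      using slot_less[of "snd u"] that len by (auto simp: g_def V' nth_append)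
    have "slot (snd u) + (if fst u then 14 else 0) = slot (snd w) + (if fst w then 14 else 0)"
      using eq nth_eq_iff_index_eq[OF dist g(2)[OF u] g(2)[OF w]] g(1)[OF u] g(1)[OF w] by simp
    then have "slot (snd u) = slot (snd w) \<and> fst u = fst w"
      using slot_less[of "snd u"] slot_less[of "snd w"] u w by (auto simp: V' split: if_splits)
    then show "u = w" using slot_inj u w by (auto simp: V' prod_eq_iff dest: inj_onD)
  qed
  have edge: "E (g u) (g w)" if uw: "E' u w" "u \<in> V'" for u w
    using uw(1) unfolding E'
  proof (elim disjE conjE)
    assume "fst w = (\<not> fst u)" "snd u = snd w"
    moreover have "E (l1 ! slot (snd u)) (l2 ! slot (snd u))" using e12 slot_less uw(2) V' by blast
    ultimately show ?thesis using E_sym by (simp add: g_def)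
  next
    assume "fst u = fst w" and D: "Delta41_E (snd u) (snd w)"
    then show ?thesis using e1 e2 E_sym
      by (cases "snd u"; cases "snd w") (auto simp: g_def Delta41_E_simps simp del: N_iff)
  qed
  have N_g: "N (g u) = g ` {w \<in> V'. E' u w}" if u: "u \<in> V'" for u
  proof (rule card_subset_eq[symmetric])
    show sub: "g ` {w \<in> V'. E' u w} \<subseteq> N (g u)"
      using edge[OF _ u] unfolding subset_iff N_iff by blast
    have "{w \<in> V'. E' u w} = insert (\<not> fst u, snd u) (Pair (fst u) ` {t. Delta41_E (snd u) t})"
      using u by (auto simp: V' E' image_iff prod_eq_iff dest: Delta41_E_in_V)
    moreover have "card (Pair (fst u) ` {t. Delta41_E (snd u) t}) = 4"
      using card_Delta41_nbrs[of "snd u"] u by (simp add: V' card_image inj_on_def)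
    moreover from this have "finite (Pair (fst u) ` {t. Delta41_E (snd u) t})"
      using card.infinite by force
    moreover have "(\<not> fst u, snd u) \<notin> Pair (fst u) ` {t. Delta41_E (snd u) t}" by auto
    ultimately have 5: "card {w \<in> V'. E' u w} = 5" by simp
    then have "{w \<in> V'. E' u w} \<noteq> {}" by (metis card.empty zero_neq_numeral)
    then have "g u \<in> V" using edge[OF _ u] E_in_V(1) by blast
    then show "card (g ` {w \<in> V'. E' u w}) = card (N (g u))"
      using 5 card_image[OF inj_on_subset[OF inj, of "{w \<in> V'. E' u w}"]] card_N m2 by simp
  qed simp
  have gV: "g ` V' \<subseteq> V"
  proof
    fix v assume "v \<in> g ` V'"
    then obtain u where u: "u \<in> V'" "v = g u" by blast
    then have "E' u (\<not> fst u, snd u)" by (simp add: E')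
    then show "v \<in> V" using edge u E_in_V(1) by blast
  qed
  have "(False, Inl 0) \<in> V'" by (simp add: V' Delta41_V_def)
  then have g0: "g (False, Inl 0) \<in> g ` V'" by (rule imageI)
  have "V \<subseteq> g ` V'"
  proof (rule connected[OF subsetD[OF gV g0] g0])
    fix u v assume "u \<in> g ` V'" "E u v"
    then show "v \<in> g ` V'" using N_g N_iff[of v u] by blast
  qed
  then have bij: "bij_betw g V' V" using gV inj by (auto simp: bij_betw_def)
  have iff: "E (g u) (g w) \<longleftrightarrow> E' u w" if "u \<in> V'" "w \<in> V'" for u w
  proof
    assume "E (g u) (g w)"
    then have "g w \<in> g ` {w \<in> V'. E' u w}" using N_g[OF that(1)] N_iff by blast
    then show "E' u w" using inj that by (auto dest: inj_onD)
  qed (use edge that in blast)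
  have "bij_betw (inv_into V' g) V V'" using bij by (rule bij_betw_inv_into)
  moreover have "E x y \<longleftrightarrow> E' (inv_into V' g x) (inv_into V' g y)" if "x \<in> V" "y \<in> V" for x y
  proof -
    have "inv_into V' g z \<in> V'" "g (inv_into V' g z) = z" if "z \<in> V" for z
      using that bij by (auto simp: bij_betw_def inv_into_into f_inv_into_f)
    then show ?thesis using iff that by metis
  qed
  ultimately show ?thesis unfolding graph_iso_def V'_def[symmetric] E'_def[symmetric] by blast
qed

section \<open>Pairs of equal left-over neighbour and pairs in \<open>N x\<close>\<close>

context exceptional
begin

lemma card_ee_eq_2:
  assumes z: "z \<in> M x y"
  shows "card (N (ee x y z) \<inter> M x y) = 2"
  using card_ee[OF z] count_U[OF z] by simp

text \<open>The classes of equal e(z) now have two elements: the vertex of \<open>U x y\<close> sees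
  both or none, any other neighbour of \<open>x\<close> at most one.\<close>

lemma same_ee_first:
  assumes z: "z \<in> M x y" "z' \<in> M x y" "ee x y z = ee x y z'" and a: "E x a" "E a z"
  shows "E a z' \<longleftrightarrow> a \<in> U x y \<or> z = z'"
proof (cases "a \<in> U x y")
  case True
  define D where "D = N (ee x y z) \<inter> M x y"
  have "card (N a \<inter> D) = card D"
    using card_ee_first[OF z(1) a(1) E_sym[OF a(2)]] card_ee_eq_2[OF z(1)] True by (simp add: D_def)
  then have "N a \<inter> D = D" by (intro card_subset_eq) (auto simp: D_def)
  moreover have "z' \<in> D" using z eeD(2)[OF z(2)] by (simp add: D_def)
  ultimately show ?thesis using True by auto
next
  case False
  then show ?thesis using ee_inj[OF a(1)] z a by (auto dest: inj_onD)
qed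

lemma first_two:
  assumes z: "z \<in> M x y" and a: "E x a" "E x b" "a \<noteq> b" "E a z" "E b z"
  shows "N z \<inter> N x = {a, b}"
proof (rule card_subset_eq[symmetric])
  show "card {a, b} = card (N z \<inter> N x)" using card_A[OF z] a m2 by simp
qed (use a E_sym in auto)

text \<open>Two neighbours of \<open>x\<close> have one common neighbour besides \<open>x\<close>;
  it lies in \<open>M x y\<close> unless they hang on the same vertex of \<open>W x y\<close>. This
  labels the vertices of \<open>M x y\<close> by pairs.\<close>

lemma pair_M:
  assumes a: "E x a" "E x b" "a \<noteq> b" and nw: "\<And>w. w \<in> W x y \<Longrightarrow> E a w \<Longrightarrow> \<not> E b w"
  obtains z where "z \<in> M x y" "E a z" "E b z"
proof -
  obtain z where z: "z \<noteq> x" "E a z" "E b z"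
    using another_common[OF a(3) E_sym[OF a(1)] E_sym[OF a(2)]] by blast
  then have "z \<in> M x y" using first_neighbour_cases[OF a(1)] nw by blast
  then show thesis using that z by blast
qed

lemma pair_unique:
  assumes a: "E x a" "E x b" "a \<noteq> b" and z: "z \<in> M x y" "E a z" "E b z" and z': "E a z'" "E b z'" "z' \<noteq> x"
  shows "z = z'"
  using common_at_most_two[OF a(3), of x z z'] a z z' E_sym M_apart(2)[OF z(1)] by blast

text \<open>Carries information from \<open>N x\<close> to \<open>N y\<close>: with only
  \<open>a\<close> shared in \<open>N x\<close> and different left-over neighbours, the second
  common neighbour can only lie in \<open>N y\<close>.\<close>

lemma second_of_first:
  assumes z: "z \<in> M x y" "z' \<in> M x y" "z \<noteq> z'" "ee x y z \<noteq> ee x y z'"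
    and a: "E x a" "E a z" "E a z'" and only: "\<And>b. E x b \<Longrightarrow> E b z \<Longrightarrow> E b z' \<Longrightarrow> b = a"
  obtains b where "E y b" "E b z" "E b z'"
proof -
  obtain v where v: "v \<noteq> a" "E z v" "E z' v"
    using another_common[OF z(3) E_sym[OF a(2)] E_sym[OF a(3)]] by blast
  have "\<not> E x v" using only[of v] v E_sym by blast
  then have "E y v" using ee_unique[OF z(1) v(2)] ee_unique[OF z(2) v(3)] z(4) by metis
  then show thesis using that v E_sym by blast
qed

lemma U_switch:
  assumes z: "z \<in> M x y" and U: "U x y = {p}" "U y x = {q}"
  shows "E p z \<longleftrightarrow> \<not> E q z"
proof -
  have "N z \<inter> U x y = (if E z p then {p} else {})" "N z \<inter> U y x = (if E z q then {q} else {})"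
    using U by auto
  then have "E z p \<longleftrightarrow> \<not> E z q" using count_U[OF z] by (simp split: if_splits)
  then show ?thesis using E_sym by blast
qed

end

section \<open>Determination of the 28 vertices and their edges\<close>

context exceptional
begin

lemma W_unique: "E x a \<Longrightarrow> w \<in> W x y \<Longrightarrow> E a w \<Longrightarrow> w' \<in> W x y \<Longrightarrow> E a w' \<Longrightarrow> w = w'"
  using W_neighbour_unique[OF _ not_isolated] by blast

lemma U_no_W: "p \<in> U x y \<Longrightarrow> w \<in> W x y \<Longrightarrow> \<not> E p w"
  unfolding U_def mem_Collect_eq disjoint_iff N_iff by blast

lemma W_pair:
  assumes "w \<in> W x y"
  obtains a b where "a \<noteq> b" "N w \<inter> N x = {a, b}"
  using card_W_first[OF assms] m2 by (auto simp: card_2_iff)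

text \<open>Both neighbours \<open>a\<close>, \<open>b\<close> of \<open>w\<close> in
  \<open>N x\<close> see the same left-over neighbours, namely \<open>N w - N x\<close>.\<close>

lemma ee_along_W:
  assumes w: "w \<in> W x y" and a: "E x a" "E a w" and b: "E x b" "E b w" and z: "z \<in> M x y" "E b z"
  obtains z' where "z' \<in> M x y" "E a z'" "ee x y z' = ee x y z"
proof -
  have "ee x y z \<in> ee x y ` (N b \<inter> M x y)" using z by simp
  then have "ee x y z \<in> ee x y ` (N a \<inter> M x y)"
    using N_W[OF w a not_isolated[OF a(1)]] N_W[OF w b not_isolated[OF b(1)]] by simp
  then show thesis using that by auto
qed

lemma other_first:
  assumes "z \<in> M x y" "E x a" "E a z"
  obtains b where "b \<noteq> a" "E x b" "E b z"
proof -
  have "z \<noteq> x" using M_apart(2) assms(1) by blast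
  then show thesis using another_common[of z x a] that assms E_sym by blast
qed

text \<open>Some \<open>z''\<close> at \<open>a\<close> has the left-over neighbour of
  \<open>z\<close>. By \<open>same_ee_first\<close> it avoids \<open>b\<close>, \<open>d\<close> and
  \<open>p\<close>, so its second neighbour in \<open>N x\<close> is \<open>c\<close>, and the pair
  \<open>a\<close>, \<open>c\<close> determines \<open>z'\<close>.\<close>

lemma ee_crossed:
  assumes U: "U x y = {p}"
    and w: "w \<in> W x y" and ab: "E x a" "E a w" "E x b" "E b w" "a \<noteq> b"
    and Nx: "N x = {a, b, c, d, p}"
    and z: "z \<in> M x y" "E b z" "E d z" "\<not> E p z" "b \<noteq> d" "\<not> E a z"
    and z': "z' \<in> M x y" "E a z'" "E c z'"
  shows "ee x y z' = ee x y z"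
proof -
  obtain z'' where z'': "z'' \<in> M x y" "E a z''" "ee x y z'' = ee x y z"
    using ee_along_W[OF w ab(1-4) z(1,2)] by blast
  have neq: "z \<noteq> z''" using z z'' by blast
  have pU: "p \<in> U x y" using U by blast
  have pab: "p \<noteq> a" "p \<noteq> b" using U_no_W[OF pU w] ab by blast+
  have Ed: "E x d" "E x p" "E x c" using Nx by (auto simp flip: N_iff)
  have "d \<noteq> p" using z by blast
  have "\<not> E b z''" "\<not> E d z''"
    using same_ee_first[OF z(1) z''(1) z''(3)[symmetric]] z(2,3) Ed ab neq U pab \<open>d \<noteq> p\<close> by auto
  moreover have "\<not> E p z''"
    using same_ee_first[OF z''(1) z(1) z''(3)] z(4) Ed U by auto
  moreover obtain u where u: "u \<noteq> a" "E x u" "E u z''" using other_first[OF z''(1) ab(1) z''(2)] by blast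
  moreover have "u \<in> {a, b, c, d, p}" using u(2) Nx N_iff by blast
  ultimately have c: "E c z''" "c \<noteq> a" by auto
  have "z'' = z'" using pair_unique[OF ab(1) Ed(3) c(2)[symmetric] z''(1,2) c(1) z'(2,3)] M_apart(2)[OF z'(1)] by blast
  then show ?thesis using z''(3) by simp
qed

text \<open>As above, but \<open>p\<close> lies in \<open>U x y\<close>, so it is adjacent to
  \<open>z''\<close> along with \<open>z\<close>; the pair \<open>a\<close>, \<open>p\<close>
  determines \<open>z'\<close>.\<close>

lemma ee_fan:
  assumes U: "U x y = {p}"
    and w: "w \<in> W x y" and ab: "E x a" "E a w" "E x b" "E b w"
    and z: "z \<in> M x y" "E b z" "E p z" and z': "z' \<in> M x y" "E a z'" "E p z'"
  shows "ee x y z' = ee x y z"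
proof -
  obtain z'' where z'': "z'' \<in> M x y" "E a z''" "ee x y z'' = ee x y z"
    using ee_along_W[OF w ab z(1,2)] by blast
  have pU: "p \<in> U x y" using U by blast
  have p: "E x p" "a \<noteq> p" using U_no_W[OF pU w] ab pU by (auto simp: U_def)
  have "E p z''" using same_ee_first[OF z(1) z''(1) z''(3)[symmetric] p(1) z(3)] U by simp
  then have "z'' = z'" using pair_unique[OF ab(1) p z''(1,2) _ z'(2,3)] M_apart(2)[OF z'(1)] by blast
  then show ?thesis using z''(3) by simp
qed

text \<open>Naming: \<open>U x y = {p5}\<close>, the two vertices \<open>w1\<close>, \<open>w2\<close> of \<open>W x y\<close> are attached to \<open>p1\<close>, \<open>p2\<close> and to
  \<open>p3\<close>, \<open>p4\<close>, and \<open>z13\<close> is the vertex of \<open>M x y\<close> attached to \<open>p1\<close>, \<open>p3\<close>; likewise \<open>q1\<close>, ..., \<open>q5\<close>, \<open>v1\<close>, \<open>v2\<close> around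
  \<open>y\<close>. The two lists of 14 vertices at the end are the two copies of \<open>Delta41\<close>, found by a computer search.\<close>

lemma iso: "graph_iso V E (cart_V K2_V Delta41_V) (cart_E K2_E Delta41_E)"
proof -
  interpret s: exceptional V E m y x by (rule exceptional_swap)
  have Ms: "M y x = M x y" and ees: "ee y x = ee x y"
    using M_sym ee_sym by (blast, intro ext)
  obtain p5 where U: "U x y = {p5}" using card_U by (rule card_1_singletonE)
  obtain q5 where U': "U y x = {q5}" using s.card_U by (rule card_1_singletonE)
  obtain w1 w2 where W: "W x y = {w1, w2}" "w1 \<noteq> w2" using card_W by (auto simp: card_2_iff)
  have wW: "w1 \<in> W x y" "w2 \<in> W x y" using W by simp_all
  obtain p1 p2 where A1: "p1 \<noteq> p2" "N w1 \<inter> N x = {p1, p2}" using W_pair[OF wW(1)] by blast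
  obtain p3 p4 where A2: "p3 \<noteq> p4" "N w2 \<inter> N x = {p3, p4}" using W_pair[OF wW(2)] by blast
  have p: "E x p1" "E x p2" "E x p3" "E x p4" "E x p5"
    using A1(2) A2(2) U by (auto simp: U_def set_eq_iff)
  have pw: "E p1 w1" "E p2 w1" "E p3 w2" "E p4 w2"
  proof -
    have "p1 \<in> N w1" "p2 \<in> N w1" "p3 \<in> N w2" "p4 \<in> N w2" using A1(2) A2(2) by blast+
    then show "E p1 w1" "E p2 w1" "E p3 w2" "E p4 w2" using E_sym by simp_all
  qed
  have W1: "w = w1" if "w \<in> W x y" "E p1 w \<or> E p2 w" for w using W_unique p pw wW that by blast
  have W2: "w = w2" if "w \<in> W x y" "E p3 w \<or> E p4 w" for w using W_unique p pw wW that by blast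
  have W5: "\<not> E p5 w" if "w \<in> W x y" for w using U_no_W[OF _ that] U by simp
  have pd: "distinct [p1, p2, p3, p4, p5]"
    using A1(1) A2(1) W1[OF wW(2)] W5[OF wW(1)] W5[OF wW(2)] pw W(2) by auto
  have Nx: "N x = {p1, p2, p3, p4, p5}"
  proof (rule card_subset_eq[symmetric])
    show "card {p1, p2, p3, p4, p5} = card (N x)" using card_N[OF xV] m2 pd by simp
  qed (use p in auto)

  obtain z13 where z13: "z13 \<in> M x y" "E p1 z13" "E p3 z13"
    using pair_M[of p1 p3] p pd W1 W2 W5 W(2) by auto
  have A13: "N z13 \<inter> N x = {p1, p3}"
    using first_two[OF z13(1) p(1,3) _ z13(2,3)] pd by simp
  obtain z24 where z24: "z24 \<in> M x y" "E p2 z24" "E p4 z24"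
    using pair_M[of p2 p4] p pd W1 W2 W5 W(2) by auto
  have A24: "N z24 \<inter> N x = {p2, p4}"
    using first_two[OF z24(1) p(2,4) _ z24(2,3)] pd by simp
  obtain z14 where z14: "z14 \<in> M x y" "E p1 z14" "E p4 z14"
    using pair_M[of p1 p4] p pd W1 W2 W5 W(2) by auto
  have A14: "N z14 \<inter> N x = {p1, p4}"
    using first_two[OF z14(1) p(1,4) _ z14(2,3)] pd by simp
  obtain z23 where z23: "z23 \<in> M x y" "E p2 z23" "E p3 z23"
    using pair_M[of p2 p3] p pd W1 W2 W5 W(2) by auto
  have A23: "N z23 \<inter> N x = {p2, p3}"
    using first_two[OF z23(1) p(2,3) _ z23(2,3)] pd by simp
  obtain z15 where z15: "z15 \<in> M x y" "E p1 z15" "E p5 z15"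
    using pair_M[of p1 p5] p pd W1 W2 W5 W(2) by auto
  have A15: "N z15 \<inter> N x = {p1, p5}"
    using first_two[OF z15(1) p(1,5) _ z15(2,3)] pd by simp
  obtain z25 where z25: "z25 \<in> M x y" "E p2 z25" "E p5 z25"
    using pair_M[of p2 p5] p pd W1 W2 W5 W(2) by auto
  have A25: "N z25 \<inter> N x = {p2, p5}"
    using first_two[OF z25(1) p(2,5) _ z25(2,3)] pd by simp
  obtain z35 where z35: "z35 \<in> M x y" "E p3 z35" "E p5 z35"
    using pair_M[of p3 p5] p pd W1 W2 W5 W(2) by auto
  have A35: "N z35 \<inter> N x = {p3, p5}"
    using first_two[OF z35(1) p(3,5) _ z35(2,3)] pd by simp
  obtain z45 where z45: "z45 \<in> M x y" "E p4 z45" "E p5 z45"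
    using pair_M[of p4 p5] p pd W1 W2 W5 W(2) by auto
  have A45: "N z45 \<inter> N x = {p4, p5}"
    using first_two[OF z45(1) p(4,5) _ z45(2,3)] pd by simp
  have nE: "\<not> E c z" if "N z \<inter> N x = {a, b}" "E x c" "c \<noteq> a" "c \<noteq> b" for a b c z
    using that E_sym by auto
  have zd: "distinct [z13, z24, z14, z23, z15, z25, z35, z45]"
  proof -
    have "distinct (map (\<lambda>z. N z \<inter> N x) [z13, z24, z14, z23, z15, z25, z35, z45])"
      unfolding list.map A13 A24 A14 A23 A15 A25 A35 A45 using pd by (auto simp: doubleton_eq_iff)
    then show ?thesis unfolding distinct_map by blast
  qed
  have q5: "E y q5" using U' by (auto simp: U_def)
  \<comment> \<open>Each vertex of \<open>M x y\<close> sees exactly one of \<open>p5\<close>,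
    \<open>q5\<close>. The four not at \<open>p5\<close> therefore have one other neighbour in
    \<open>N y\<close>, which defines \<open>q1\<close> to \<open>q4\<close>.\<close>
  have q5z13: "E q5 z13" using U_switch[OF z13(1) U U'] nE[OF A13 p(5)] pd by auto
  have zM13: "z13 \<in> M y x" using z13 Ms by simp
  obtain q1 where q1: "q1 \<noteq> q5" "E y q1" "E q1 z13" using s.other_first[OF zM13 q5 q5z13] by blast
  have B13: "N z13 \<inter> N y = {q5, q1}" using s.first_two[OF zM13 q5 q1(2) q1(1)[symmetric] q5z13 q1(3)] .
  have q5z24: "E q5 z24" using U_switch[OF z24(1) U U'] nE[OF A24 p(5)] pd by auto
  have zM24: "z24 \<in> M y x" using z24 Ms by simp
  obtain q2 where q2: "q2 \<noteq> q5" "E y q2" "E q2 z24" using s.other_first[OF zM24 q5 q5z24] by blast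
  have B24: "N z24 \<inter> N y = {q5, q2}" using s.first_two[OF zM24 q5 q2(2) q2(1)[symmetric] q5z24 q2(3)] .
  have q5z14: "E q5 z14" using U_switch[OF z14(1) U U'] nE[OF A14 p(5)] pd by auto
  have zM14: "z14 \<in> M y x" using z14 Ms by simp
  obtain q3 where q3: "q3 \<noteq> q5" "E y q3" "E q3 z14" using s.other_first[OF zM14 q5 q5z14] by blast
  have B14: "N z14 \<inter> N y = {q5, q3}" using s.first_two[OF zM14 q5 q3(2) q3(1)[symmetric] q5z14 q3(3)] .
  have q5z23: "E q5 z23" using U_switch[OF z23(1) U U'] nE[OF A23 p(5)] pd by auto
  have zM23: "z23 \<in> M y x" using z23 Ms by simp
  obtain q4 where q4: "q4 \<noteq> q5" "E y q4" "E q4 z23" using s.other_first[OF zM23 q5 q5z23] by blast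
  have B23: "N z23 \<inter> N y = {q5, q4}" using s.first_two[OF zM23 q5 q4(2) q4(1)[symmetric] q5z23 q4(3)] .
  have qd: "distinct [q1, q2, q3, q4, q5]"
  proof -
    \<comment> \<open>Otherwise \<open>q\<close> and \<open>q5\<close> would share \<open>y\<close>,
      \<open>z\<close> and \<open>z'\<close>.\<close>
    have "q \<noteq> q'" if "N z \<inter> N y = {q5, q}" "N z' \<inter> N y = {q5, q'}" "z \<in> M y x" "z' \<in> M y x" "z \<noteq> z'" "q \<noteq> q5" for q q' z z'
    proof
      assume "q = q'"
      then have "E q z" "E q z'" "E q5 z" "E q5 z'" "E y q" using that E_sym by (auto simp: set_eq_iff)
      then show False
        using s.pair_unique[OF q5 _ _ that(3), of q z'] s.M_apart(2)[OF that(4)] that(5,6) by blast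
    qed
    note ne = this
    show ?thesis
      using ne[OF B13 B24 zM13 zM24] ne[OF B13 B14 zM13 zM14] ne[OF B13 B23 zM13 zM23]
        ne[OF B24 B14 zM24 zM14] ne[OF B24 B23 zM24 zM23] ne[OF B14 B23 zM14 zM23] q1(1) q2(1) q3(1) q4(1) zd by auto
  qed
  have Ny: "N y = {q1, q2, q3, q4, q5}"
  proof (rule card_subset_eq[symmetric])
    show "card {q1, q2, q3, q4, q5} = card (N y)" using card_N[OF yV] m2 qd by simp
  qed (use q1 q2 q3 q4 q5 in auto)
  \<comment> \<open>One vertex for each of the four classes {z13, z24}, {z14, z23}, {z15, z25},
    {z35, z45} of equal left-over neighbour.\<close>
  define e1 where "e1 = ee x y z13"
  define e2 where "e2 = ee x y z14"
  define e3 where "e3 = ee x y z15"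
  define e4 where "e4 = ee x y z35"
  have e24: "ee x y z24 = e1" unfolding e1_def
    by (rule ee_crossed[OF U wW(1) p(1) pw(1) p(2) pw(2) A1(1) _ z24 _ _ _ z13, symmetric])
      (use Nx nE[OF A24 p(5)] nE[OF A24 p(1)] pd in auto)
  have e23: "ee x y z23 = e2" unfolding e2_def
    by (rule ee_crossed[OF U wW(1) p(1) pw(1) p(2) pw(2) A1(1) _ z23 _ _ _ z14, symmetric])
      (use Nx nE[OF A23 p(5)] nE[OF A23 p(1)] pd in auto)
  have e25: "ee x y z25 = e3" unfolding e3_def
    by (rule ee_fan[OF U wW(1) p(1) pw(1) p(2) pw(2) z25 z15, symmetric])
  have e45: "ee x y z45 = e4" unfolding e4_def
    by (rule ee_fan[OF U wW(2) p(3) pw(3) p(4) pw(4) z45 z35, symmetric])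
  have inj: "ee x y z \<noteq> ee x y z'" if "E x a" "a \<noteq> p5" "z \<in> M x y" "z' \<in> M x y" "E a z" "E a z'" "z \<noteq> z'" for a z z'
    using same_ee_first[OF that(3,4) _ that(1,5)] that U by auto
  have ed: "distinct [e1, e2, e3, e4]"
  proof -
    \<comment> \<open>\<open>inj\<close> separates vertices along a shared neighbour other than
      \<open>p5\<close>, but these two classes share only \<open>p5\<close>; here the class size 2
      decides.\<close>
    have "e3 \<noteq> e4"
    proof
      assume "e3 = e4"
      then have "{z15, z25, z35} \<subseteq> N (ee x y z15) \<inter> M x y"
        using z15 z25 z35 eeD(2)[OF z15(1)] eeD(2)[OF z25(1)] eeD(2)[OF z35(1)] e25 by (simp add: e3_def e4_def)
      then have "card {z15, z25, z35} \<le> 2" using card_mono[of "N (ee x y z15) \<inter> M x y"] card_ee_eq_2[OF z15(1)] by (metis finite_Int finite_N)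
      then show False using zd by simp
    qed
    moreover have "e1 \<noteq> e2" "e1 \<noteq> e3" "e2 \<noteq> e3"
      using inj[OF p(1) _ z13(1) z14(1) z13(2) z14(2)] inj[OF p(1) _ z13(1) z15(1) z13(2) z15(2)]
        inj[OF p(1) _ z14(1) z15(1) z14(2) z15(2)] pd zd by (auto simp: e1_def e2_def e3_def)
    moreover have "e1 \<noteq> e4" using inj[OF p(3) _ z13(1) z35(1) z13(3) z35(2)] pd zd by (auto simp: e1_def e4_def)
    moreover have "e2 \<noteq> e4" using inj[OF p(4) _ z14(1) z45(1) z14(3) z45(2)] pd zd e45 by (auto simp: e2_def)
    ultimately show ?thesis by auto
  qed
  have nE': "c = a \<or> c = b" if "N z \<inter> N y = {a, b}" "E y c" "E c z" for a b c z
    using that E_sym by auto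
  have nq5z15: "\<not> E q5 z15" using U_switch[OF z15(1) U U'] z15(3) by simp
  have nq5z25: "\<not> E q5 z25" using U_switch[OF z25(1) U U'] z25(3) by simp
  have nq5z35: "\<not> E q5 z35" using U_switch[OF z35(1) U U'] z35(3) by simp
  have nq5z45: "\<not> E q5 z45" using U_switch[OF z45(1) U U'] z45(3) by simp
  \<comment> \<open>\<open>z13\<close> and \<open>z15\<close> share only \<open>p1\<close> in
    \<open>N x\<close>, so they share a vertex of \<open>N y\<close>; of the two candidates at
    \<open>z13\<close>, \<open>q5\<close> misses \<open>z15\<close>. The next seven edges arise
    likewise.\<close>
  have q1z15: "E q1 z15"
  proof -
    have ne: "ee x y z13 \<noteq> ee x y z15" unfolding e1_def[symmetric] e3_def[symmetric] using ed by simp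
    have "z13 \<noteq> z15" using zd by simp
    moreover have "b = p1" if "E x b" "E b z13" "E b z15" for b
      using nE[OF A13 that(1)] nE[OF A15 that(1)] that pd by auto
    ultimately obtain b where b: "E y b" "E b z13" "E b z15"
      using second_of_first[OF z13(1) z15(1) _ ne p(1) z13(2) z15(2)] by blast
    then have "b = q1" using nE'[OF B13 b(1,2)] nq5z15 by blast
    then show ?thesis using b by simp
  qed
  have q3z15: "E q3 z15"
  proof -
    have ne: "ee x y z14 \<noteq> ee x y z15" unfolding e2_def[symmetric] e3_def[symmetric] using ed by simp
    have "z14 \<noteq> z15" using zd by simp
    moreover have "b = p1" if "E x b" "E b z14" "E b z15" for b
      using nE[OF A14 that(1)] nE[OF A15 that(1)] that pd by auto
    ultimately obtain b where b: "E y b" "E b z14" "E b z15"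
      using second_of_first[OF z14(1) z15(1) _ ne p(1) z14(2) z15(2)] by blast
    then have "b = q3" using nE'[OF B14 b(1,2)] nq5z15 by blast
    then show ?thesis using b by simp
  qed
  have q2z25: "E q2 z25"
  proof -
    have ne: "ee x y z24 \<noteq> ee x y z25" unfolding e24 e25 using ed by simp
    have "z24 \<noteq> z25" using zd by simp
    moreover have "b = p2" if "E x b" "E b z24" "E b z25" for b
      using nE[OF A24 that(1)] nE[OF A25 that(1)] that pd by auto
    ultimately obtain b where b: "E y b" "E b z24" "E b z25"
      using second_of_first[OF z24(1) z25(1) _ ne p(2) z24(2) z25(2)] by blast
    then have "b = q2" using nE'[OF B24 b(1,2)] nq5z25 by blast
    then show ?thesis using b by simp
  qed
  have q4z25: "E q4 z25"
  proof -
    have ne: "ee x y z23 \<noteq> ee x y z25" unfolding e23 e25 using ed by simp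
    have "z23 \<noteq> z25" using zd by simp
    moreover have "b = p2" if "E x b" "E b z23" "E b z25" for b
      using nE[OF A23 that(1)] nE[OF A25 that(1)] that pd by auto
    ultimately obtain b where b: "E y b" "E b z23" "E b z25"
      using second_of_first[OF z23(1) z25(1) _ ne p(2) z23(2) z25(2)] by blast
    then have "b = q4" using nE'[OF B23 b(1,2)] nq5z25 by blast
    then show ?thesis using b by simp
  qed
  have q1z35: "E q1 z35"
  proof -
    have ne: "ee x y z13 \<noteq> ee x y z35" unfolding e1_def[symmetric] e4_def[symmetric] using ed by simp
    have "z13 \<noteq> z35" using zd by simp
    moreover have "b = p3" if "E x b" "E b z13" "E b z35" for b
      using nE[OF A13 that(1)] nE[OF A35 that(1)] that pd by auto
    ultimately obtain b where b: "E y b" "E b z13" "E b z35"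
      using second_of_first[OF z13(1) z35(1) _ ne p(3) z13(3) z35(2)] by blast
    then have "b = q1" using nE'[OF B13 b(1,2)] nq5z35 by blast
    then show ?thesis using b by simp
  qed
  have q4z35: "E q4 z35"
  proof -
    have ne: "ee x y z23 \<noteq> ee x y z35" unfolding e23 e4_def[symmetric] using ed by simp
    have "z23 \<noteq> z35" using zd by simp
    moreover have "b = p3" if "E x b" "E b z23" "E b z35" for b
      using nE[OF A23 that(1)] nE[OF A35 that(1)] that pd by auto
    ultimately obtain b where b: "E y b" "E b z23" "E b z35"
      using second_of_first[OF z23(1) z35(1) _ ne p(3) z23(3) z35(2)] by blast
    then have "b = q4" using nE'[OF B23 b(1,2)] nq5z35 by blast
    then show ?thesis using b by simp
  qed
  have q3z45: "E q3 z45"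
  proof -
    have ne: "ee x y z14 \<noteq> ee x y z45" unfolding e2_def[symmetric] e45 using ed by simp
    have "z14 \<noteq> z45" using zd by simp
    moreover have "b = p4" if "E x b" "E b z14" "E b z45" for b
      using nE[OF A14 that(1)] nE[OF A45 that(1)] that pd by auto
    ultimately obtain b where b: "E y b" "E b z14" "E b z45"
      using second_of_first[OF z14(1) z45(1) _ ne p(4) z14(3) z45(2)] by blast
    then have "b = q3" using nE'[OF B14 b(1,2)] nq5z45 by blast
    then show ?thesis using b by simp
  qed
  have q2z45: "E q2 z45"
  proof -
    have ne: "ee x y z24 \<noteq> ee x y z45" unfolding e24 e45 using ed by simp
    have "z24 \<noteq> z45" using zd by simp
    moreover have "b = p4" if "E x b" "E b z24" "E b z45" for b
      using nE[OF A24 that(1)] nE[OF A45 that(1)] that pd by auto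
    ultimately obtain b where b: "E y b" "E b z24" "E b z45"
      using second_of_first[OF z24(1) z45(1) _ ne p(4) z24(3) z45(2)] by blast
    then have "b = q2" using nE'[OF B24 b(1,2)] nq5z45 by blast
    then show ?thesis using b by simp
  qed
  have "q1 \<notin> U y x" using U' qd by simp
  then obtain u1 where u1: "u1 \<in> W y x" "E q1 u1" using q1(2) by (auto simp: U_def)
  have "q2 \<notin> U y x" using U' qd by simp
  then obtain u2 where u2: "u2 \<in> W y x" "E q2 u2" using q2(2) by (auto simp: U_def)
  have "q3 \<notin> U y x" using U' qd by simp
  then obtain u3 where u3: "u3 \<in> W y x" "E q3 u3" using q3(2) by (auto simp: U_def)
  have "q4 \<notin> U y x" using U' qd by simp
  then obtain u4 where u4: "u4 \<in> W y x" "E q4 u4" using q4(2) by (auto simp: U_def)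
  have adj: "E u (ee x y z)" if "E y b" "u \<in> W y x" "E b u" "z \<in> M x y" "E b z" for b u z
    using s.W_adj_ee[OF that(1-3)] that(4,5) unfolding Ms ees by blast
  \<comment> \<open>e(z) has as many neighbours in \<open>W y x\<close> as \<open>z\<close> has in
    \<open>N y\<close> outside \<open>U y x\<close>, which is one here since \<open>q5\<close> is
    discounted. So \<open>q1\<close>, \<open>q2\<close> hang on the same vertex of
    \<open>W y x\<close>, and so do \<open>q3\<close>, \<open>q4\<close>.\<close>
  have one: "u = u'" if "z \<in> M x y" "N z \<inter> N y = {q5, q}" "q \<noteq> q5" "u \<in> W y x" "u' \<in> W y x" "E u (ee x y z)" "E u' (ee x y z)" for z q u u'
  proof -
    have "card (N (ee x y z) \<inter> W y x) = card ({q5, q} - {q5})"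
      using s.N_ee_subset(2)[of z] that(1) unfolding Ms ees that(2) U' by simp
    also have "{q5, q} - {q5} = {q}" using that(3) by blast
    finally have "card (N (ee x y z) \<inter> W y x) = 1" by simp
    moreover have "u \<in> N (ee x y z) \<inter> W y x" "u' \<in> N (ee x y z) \<inter> W y x" using that E_sym by simp_all
    ultimately show ?thesis by (metis card_1_singletonE singletonD)
  qed
  have "E u1 e1" "E u2 e1" "E u3 e2" "E u4 e2"
    using adj[OF q1(2) u1 z13(1) q1(3)] adj[OF q2(2) u2 z24(1) q2(3)] adj[OF q3(2) u3 z14(1) q3(3)] adj[OF q4(2) u4 z23(1) q4(3)]
    unfolding e24 e23 e1_def e2_def by simp_all
  then have u_eq: "u2 = u1" "u4 = u3"
    using one[OF z13(1) B13 q1(1) u1(1) u2(1)] one[OF z14(1) B14 q3(1) u3(1) u4(1)] unfolding e1_def e2_def by simp_all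
  have "u1 \<noteq> u3"
  proof
    assume "u1 = u3"
    then have "{q1, q2, q3} \<subseteq> N u1 \<inter> N y" using u1 u2 u3 u_eq q1 q2 q3 E_sym by auto
    then have "card {q1, q2, q3} \<le> 2" using card_mono[of "N u1 \<inter> N y" "{q1, q2, q3}"] s.card_W_first[OF u1(1)] m2 by simp
    then show False using qd by simp
  qed
  define v1 where "v1 = u1"
  define v2 where "v2 = u3"
  have v: "v1 \<in> W y x" "v2 \<in> W y x" "v1 \<noteq> v2" "E q1 v1" "E q2 v1" "E q3 v2" "E q4 v2"
    using u1 u2 u3 u4 u_eq \<open>u1 \<noteq> u3\<close> by (simp_all add: v1_def v2_def)
  have ev: "E v1 e1" "E v2 e2" "E v1 e3" "E v2 e3" "E v1 e4" "E v2 e4"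
    using adj[OF q1(2) v(1,4) z13(1) q1(3)] adj[OF q3(2) v(2,6) z14(1) q3(3)] adj[OF q1(2) v(1,4) z15(1) q1z15]
      adj[OF q3(2) v(2,6) z15(1) q3z15] adj[OF q1(2) v(1,4) z35(1) q1z35] adj[OF q4(2) v(2,7) z35(1) q4z35]
    unfolding e1_def e2_def e3_def e4_def by simp_all
  have ew: "E w1 e1" "E w2 e1" "E w1 e2" "E w2 e2" "E w1 e3" "E w2 e4"
    using W_adj_ee[OF p(1) wW(1) pw(1) z13(1,2)] W_adj_ee[OF p(3) wW(2) pw(3) z13(1,3)]
      W_adj_ee[OF p(1) wW(1) pw(1) z14(1,2)] W_adj_ee[OF p(4) wW(2) pw(4) z14(1,3)]
      W_adj_ee[OF p(1) wW(1) pw(1) z15(1,2)] W_adj_ee[OF p(3) wW(2) pw(3) z35(1,2)]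
    unfolding e1_def e2_def e3_def e4_def by simp_all
  have ez: "E z13 e1" "E z24 e1" "E z14 e2" "E z23 e2" "E z15 e3" "E z25 e3" "E z35 e4" "E z45 e4"
    using eeD(1)[OF z13(1)] eeD(1)[OF z24(1)] eeD(1)[OF z14(1)] eeD(1)[OF z23(1)] eeD(1)[OF z15(1)] eeD(1)[OF z25(1)] eeD(1)[OF z35(1)] eeD(1)[OF z45(1)]
    unfolding e24 e23 e25 e45 e1_def e2_def e3_def e4_def by simp_all
  \<comment> \<open>These are 70 = 28 * 5 / 2 facts, one for each edge.\<close>
  note edges = p pw z13(2,3) z24(2,3) z14(2,3) z23(2,3) z15(2,3) z25(2,3) z35(2,3) z45(2,3) q1(2,3) q2(2,3) q3(2,3) q4(2,3) q5 q5z13 q5z24 q5z14 q5z23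
    q1z15 q3z15 q2z25 q4z25 q1z35 q4z35 q3z45 q2z45 v(4-7) ev ew ez
  note edges' = edges edges[THEN E_sym]
  let ?Ps = "[p1, p2, p3, p4, p5]" and ?Qs = "[q1, q2, q3, q4, q5]"
    and ?Zs = "[z13, z24, z14, z23, z15, z25, z35, z45]" and ?Es = "[e1, e2, e3, e4]"
  have E_ee: "set ?Es \<subseteq> ee x y ` M x y"
    unfolding e1_def e2_def e3_def e4_def using z13 z14 z15 z35 by simp
  have ee_W: "e \<notin> W x y" "e \<notin> W y x" "e \<notin> M x y" if e: "e \<in> ee x y ` M x y" for e
  proof -
    obtain z where z: "z \<in> M x y" "e = ee x y z" using e by blast
    show "e \<notin> W x y" using W_apart(8) ee_no_first[OF z(1)] z(2) by blast
    show "e \<notin> W y x" using s.W_apart(8) s.ee_no_first[of z] z unfolding Ms ees by blast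
    show "e \<notin> M x y" using ee_notin_M[OF z(1)] z(2) by simp
  qed
  \<comment> \<open>The cells are pairwise disjoint, so distinctness is only at stake inside each
    cell.\<close>
  have "distinct ([x] @ [y] @ ?Ps @ ?Qs @ ?Zs @ [w1, w2] @ [v1, v2] @ ?Es)"
  proof -
    have c: "set ?Ps \<subseteq> N x" "set ?Qs \<subseteq> N y" "set ?Zs \<subseteq> M x y" "set [w1, w2] \<subseteq> W x y" "set [v1, v2] \<subseteq> W y x"
      using Nx Ny z13(1) z24(1) z14(1) z23(1) z15(1) z25(1) z35(1) z45(1) wW v by auto
    have disj: "N x \<inter> N y = {}" "N x \<inter> M x y = {}" "N y \<inter> M x y = {}"
      "N x \<inter> W x y = {}" "N x \<inter> W y x = {}" "N y \<inter> W x y = {}" "N y \<inter> W y x = {}"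
      "M x y \<inter> W x y = {}" "M x y \<inter> W y x = {}" "W x y \<inter> W y x = {}"
      using no_common M_apart(4,5) W_apart(2,6,7) s.W_apart(2,6,7) W_disjoint unfolding Ms by auto
    have disj_e: "N x \<inter> ee x y ` M x y = {}" "N y \<inter> ee x y ` M x y = {}" "M x y \<inter> ee x y ` M x y = {}"
      "W x y \<inter> ee x y ` M x y = {}" "W y x \<inter> ee x y ` M x y = {}"
      using ee_image_notin(1,2) ee_W by auto
    have xy: "x \<notin> N x" "y \<notin> N x" "x \<notin> N y" "y \<notin> N y" "x \<notin> M x y" "y \<notin> M x y"
      "x \<notin> W x y" "y \<notin> W x y" "x \<notin> W y x" "y \<notin> W y x" "x \<notin> ee x y ` M x y" "y \<notin> ee x y ` M x y"
    proof -
      show "x \<notin> N x" "y \<notin> N x" "x \<notin> N y" "y \<notin> N y" using E_irrefl not_adjacent by simp_all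
      show "x \<notin> M x y" "y \<notin> M x y" using M_apart(2,3) by blast+
      show "x \<notin> W x y" "y \<notin> W y x" using W_apart(1) s.W_apart(1) by blast+
      show "y \<notin> W x y" "x \<notin> W y x" using W_apart(8) s.W_apart(8) no_common E_sym by blast+
      show "x \<notin> ee x y ` M x y" "y \<notin> ee x y ` M x y" using ee_image_notin(3,4) by blast+
    qed
    have app: "distinct (as @ bs) \<and> set (as @ bs) \<subseteq> A \<union> B"
      if "distinct bs \<and> set bs \<subseteq> B" "distinct as \<and> set as \<subseteq> A" "A \<inter> B = {}" for as bs :: "'a list" and A B
      using that unfolding distinct_append set_append by blast
    have "distinct ?Es \<and> set ?Es \<subseteq> ee x y ` M x y" using ed E_ee by blast
    moreover have "distinct [v1, v2] \<and> set [v1, v2] \<subseteq> W y x" using v(1-3) by simp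
    moreover have "W y x \<inter> ee x y ` M x y = {}" by (rule disj_e(5))
    ultimately have "distinct ([v1, v2] @ ?Es) \<and> set ([v1, v2] @ ?Es) \<subseteq> W y x \<union> ee x y ` M x y"
      by (rule app)
    moreover have "distinct [w1, w2] \<and> set [w1, w2] \<subseteq> W x y" using W(2) wW by simp
    moreover have "W x y \<inter> (W y x \<union> ee x y ` M x y) = {}" by (simp only: Int_Un_distrib disj disj_e Un_empty simp_thms)
    ultimately have "distinct ([w1, w2] @ [v1, v2] @ ?Es) \<and> set ([w1, w2] @ [v1, v2] @ ?Es) \<subseteq> W x y \<union> (W y x \<union> ee x y ` M x y)"
      by (rule app)
    moreover have "distinct ?Zs \<and> set ?Zs \<subseteq> M x y" using zd c(3) by blast
    moreover have "M x y \<inter> (W x y \<union> (W y x \<union> ee x y ` M x y)) = {}" by (simp only: Int_Un_distrib disj disj_e Un_empty simp_thms)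
    ultimately have "distinct (?Zs @ [w1, w2] @ [v1, v2] @ ?Es) \<and> set (?Zs @ [w1, w2] @ [v1, v2] @ ?Es) \<subseteq> M x y \<union> (W x y \<union> (W y x \<union> ee x y ` M x y))"
      by (rule app)
    moreover have "distinct ?Qs \<and> set ?Qs \<subseteq> N y" using qd c(2) by blast
    moreover have "N y \<inter> (M x y \<union> (W x y \<union> (W y x \<union> ee x y ` M x y))) = {}" by (simp only: Int_Un_distrib disj disj_e Un_empty simp_thms)
    ultimately have "distinct (?Qs @ ?Zs @ [w1, w2] @ [v1, v2] @ ?Es) \<and> set (?Qs @ ?Zs @ [w1, w2] @ [v1, v2] @ ?Es)
        \<subseteq> N y \<union> (M x y \<union> (W x y \<union> (W y x \<union> ee x y ` M x y)))"
      by (rule app)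
    moreover have "distinct ?Ps \<and> set ?Ps \<subseteq> N x" using pd c(1) by blast
    moreover have "N x \<inter> (N y \<union> (M x y \<union> (W x y \<union> (W y x \<union> ee x y ` M x y)))) = {}" by (simp only: Int_Un_distrib disj disj_e Un_empty simp_thms)
    ultimately have "distinct (?Ps @ ?Qs @ ?Zs @ [w1, w2] @ [v1, v2] @ ?Es) \<and> set (?Ps @ ?Qs @ ?Zs @ [w1, w2] @ [v1, v2] @ ?Es)
        \<subseteq> N x \<union> (N y \<union> (M x y \<union> (W x y \<union> (W y x \<union> ee x y ` M x y))))"
      by (rule app)
    moreover have "distinct [x, y] \<and> set [x, y] \<subseteq> {x, y}" using xy_neq by simp
    moreover have "{x, y} \<inter> (N x \<union> (N y \<union> (M x y \<union> (W x y \<union> (W y x \<union> ee x y ` M x y))))) = {}"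
      using xy by (simp only: Int_insert_left Un_iff if_False simp_thms Int_empty_left)
    ultimately have "distinct ([x, y] @ ?Ps @ ?Qs @ ?Zs @ [w1, w2] @ [v1, v2] @ ?Es) \<and> set ([x, y] @ ?Ps @ ?Qs @ ?Zs @ [w1, w2] @ [v1, v2] @ ?Es)
        \<subseteq> {x, y} \<union> (N x \<union> (N y \<union> (M x y \<union> (W x y \<union> (W y x \<union> ee x y ` M x y)))))"
      by (rule app)
    then show ?thesis by simp
  qed
  then have "card (set ([x] @ [y] @ ?Ps @ ?Qs @ ?Zs @ [w1, w2] @ [v1, v2] @ ?Es)) = 28"
    by (subst distinct_card) simp_all
  \<comment> \<open>The two copies only rearrange the 28 vertices, so their concatenation, of length
    28, is distinct because its set has 28 elements.\<close>
  moreover have "set ([x] @ [y] @ ?Ps @ ?Qs @ ?Zs @ [w1, w2] @ [v1, v2] @ ?Es) = set ([x, z23, w2, z14, z24, z13, w1, e1, p1, p2, p3, e2, p4, q5] @ [p5, q4, e4, q3, q2, q1, e3, v1, z15, z25, z35, v2, z45, y])"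
    by (auto simp only: set_append list.set)
  ultimately have dist: "distinct ([x, z23, w2, z14, z24, z13, w1, e1, p1, p2, p3, e2, p4, q5] @ [p5, q4, e4, q3, q2, q1, e3, v1, z15, z25, z35, v2, z45, y])"
    by (intro card_distinct) simp
  show ?thesis
  proof (rule iso_of_lists[OF m2 _ _ dist])
    show "E ([x, z23, w2, z14, z24, z13, w1, e1, p1, p2, p3, e2, p4, q5] ! i) ([x, z23, w2, z14, z24, z13, w1, e1, p1, p2, p3, e2, p4, q5] ! (7 + j))" if "inc41 i j" for i j
    proof -
      have "i \<in> {0, 1, 2, 3, 4, 5, 6}" "j \<in> {0, 1, 2, 3, 4, 5, 6}" using that by (auto simp: inc41_def)
      then show ?thesis using that by (elim insertE emptyE) (simp_all add: inc41_def edges')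
    qed
    show "E ([p5, q4, e4, q3, q2, q1, e3, v1, z15, z25, z35, v2, z45, y] ! i) ([p5, q4, e4, q3, q2, q1, e3, v1, z15, z25, z35, v2, z45, y] ! (7 + j))" if "inc41 i j" for i j
    proof -
      have "i \<in> {0, 1, 2, 3, 4, 5, 6}" "j \<in> {0, 1, 2, 3, 4, 5, 6}" using that by (auto simp: inc41_def)
      then show ?thesis using that by (elim insertE emptyE) (simp_all add: inc41_def edges')
    qed
    show "E ([x, z23, w2, z14, z24, z13, w1, e1, p1, p2, p3, e2, p4, q5] ! i) ([p5, q4, e4, q3, q2, q1, e3, v1, z15, z25, z35, v2, z45, y] ! i)" if "i < 14" for i
    proof -
      have "i \<in> {0, 1, 2, 3, 4, 5, 6, 7, 8, 9, 10, 11, 12, 13}"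
        using that unfolding insert_iff empty_iff by presburger
      then show ?thesis by (elim insertE emptyE) (simp_all add: edges')
    qed
  qed simp_all
qed

end

section \<open>From amply regular graphs to the two alternatives\<close>

theorem theorem3p6:
  fixes V :: "'a set" and E :: "'a \<Rightarrow> 'a \<Rightarrow> bool"
    and v k lam mu :: nat
  assumes "amply_regular V E v k lam mu"
    and "connected_graph V E"
    and "has_diameter V E 4"
    and "2 * mu = k - 1"
    and "odd k" and "k \<ge> 5"
  shows "graph_iso V E (cart_V K2_V Delta41_V) (cart_E K2_E Delta41_E)
    \<or> (bipartite V E \<and>
        (\<forall>x\<in>V. \<exists>D3 D3'. D3 \<union> D3' = Gam V E 3 x \<and>
           map card [{x}, Gam V E 1 x, Gam V E 2 x, D3, D3', Gam V E 4 x]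
             = [1, k, 2 * k, k, 2, 1] \<and>
           equitable_partition V E [{x}, Gam V E 1 x, Gam V E 2 x, D3, D3', Gam V E 4 x]
             [[0, k, 0, 0, 0, 0],
              [1, 0, k - 1, 0, 0, 0],
              [0, (k - 1) div 2, 0, (k - 1) div 2, 1, 0],
              [0, 0, k - 1, 0, 0, 1],
              [0, 0, k, 0, 0, 0],
              [0, 0, 0, k, 0, 0]]))"
proof -
  have k: "k = 2 * mu + 1" and mu: "2 \<le> mu" using assms(4,6) by linarith+
  have simple: "simple_graph V E" and card_nbrs: "\<And>x. x \<in> V \<Longrightarrow> card (nbrs V E x) = 2 * mu + 1"
    and lam: "\<And>x y. x \<in> V \<Longrightarrow> y \<in> V \<Longrightarrow> E x y \<Longrightarrow> card (nbrs V E x \<inter> nbrs V E y) = lam"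
    and dist2: "\<And>x y. x \<in> V \<Longrightarrow> y \<in> V \<Longrightarrow> dist_is V E x y 2 \<Longrightarrow> card (nbrs V E x \<inter> nbrs V E y) = mu"
    using assms(1) unfolding amply_regular_def k by blast+
  interpret sgraph V E by unfold_locales (rule simple)
  interpret amply V E mu lam
  proof unfold_locales
    fix x y assume xy: "x \<noteq> y" "\<not> E x y" "N x \<inter> N y \<noteq> {}"
    then have "x \<in> V" "y \<in> V" using E_in_V(1) by auto
    then show "card (N x \<inter> N y) = mu" using dist2 xy unfolding dist_is_2 by blast
  qed (use card_nbrs mu lam E_in_V in blast)+
  have far_M: "M x y \<noteq> {}" if "far x y" for x y
  proof -
    have "x \<in> V" "y \<in> V" "\<forall>n<4. \<not> walk V E x y n" using that unfolding far_walk by blast+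
    moreover then obtain n where "n \<le> 4" "walk V E x y n"
      using assms(3) unfolding has_diameter_def by blast
    ultimately have "walk V E x y 4" by (metis le_neq_implies_less)
    then show ?thesis unfolding M_walk .
  qed
  obtain x0 y0 where far: "far x0 y0"
    using assms(3) unfolding has_diameter_def dist_is_4 by blast
  have "lam = 0" by (rule lam_eq_0[OF far far_M[OF far]])
  \<comment> \<open>With lam = 0 adjacent vertices have no common neighbour, which gives both
    triangle-freeness and the simplified mu clause; connectivity becomes closure by induction on the
    length of a walk.\<close>
  interpret tfree V E mu
  proof unfold_locales
    fix x y z assume "E x y" "E y z"
    show "\<not> E x z"
    proof
      assume "E x z"
      then have "z \<in> N x \<inter> N y" using \<open>E y z\<close> by simp
      moreover have "card (N x \<inter> N y) = 0" using card_lam[OF \<open>E x y\<close>] \<open>lam = 0\<close> by simp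
      then have "N x \<inter> N y = {}" by (simp add: card_eq_0_iff)
      ultimately show False by blast
    qed
  next
    fix x y z assume xy: "x \<noteq> y" "E x z" "E y z"
    then have "z \<in> N x \<inter> N y" by simp
    moreover have "\<not> E x y"
    proof
      assume "E x y"
      then have "card (N x \<inter> N y) = 0" using card_lam \<open>lam = 0\<close> by simp
      then have "N x \<inter> N y = {}" by (simp add: card_eq_0_iff)
      then show False using calculation by blast
    qed
    ultimately show "card (N x \<inter> N y) = mu" using card_mu xy(1) by blast
  next
    fix x :: 'a and A assume x: "x \<in> V" "x \<in> A" and closed: "\<And>u v. u \<in> A \<Longrightarrow> E u v \<Longrightarrow> v \<in> A"
    have "v \<in> A" if "walk V E x v n" for v n
      using that
    proof (induction n arbitrary: v)
      case 0
      then show ?case using x by (simp add: walk_0)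
    next
      case (Suc n)
      then show ?case using closed unfolding walk_Suc by blast
    qed
    then show "V \<subseteq> A" using assms(2) x(1) unfolding connected_graph_def by blast
  qed (use card_nbrs mu far_M in blast)+
  interpret far_pair V E mu x0 y0 by unfold_locales (rule far)
  show ?thesis
  proof (cases "W x0 y0 = {}")
    case True
    then have "good_pair V E mu x0 y0" by unfold_locales
    from bipartite_partition[OF this] show ?thesis unfolding k by simp
  next
    case False
    then have "\<not> 3 \<le> mu" using O_empty W_empty[OF far_M[OF far]] by blast
    then have "mu = 2" using mu by simp
    then interpret exceptional V E mu x0 y0 using False by unfold_locales
    show ?thesis using iso by blast
  qed
qed

end
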